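(* Every circulant graph of prime order has the Tinhofer property.
   Context: Graphs are directed graphs without loops (undirected graphs are the special case of a symmetric edge relation). For a finite group $A$ with neutral element $e$ and $S\subseteq A\setminus\{e\}$, the Cayley graph $\mathrm{Cay}(A,S)$ has vertex set $A$ and edge set $\{(h,sh): h\in A, s\in S\}$. A circulant graph of order $n$ is a Cayley graph over the cyclic group $\mathbb{Z}_n$. Color Refinement: given a coloring $c$ of the vertices of a graph $(V,E)$, one step refines the coloring by splitting vertices: two vertices $v,v'$ keep the same color iff $c(v)=c(v')$ and the multisets $\{\{c(h): h\in V, (h,v)\in E\}\}$ and $\{\{c(h): h\in V, (h,v')\in E\}\}$ of colors of in-neighbors coincide. The step is repeated until the partition of the vertices into color classes stabilizes. Tinhofer's algorithm for two graphs $G$ and $H$: (1) Give every vertex of the disjoint union of $G$ and $H$ the same color. (2) Run Color Refinement on the current coloring of $V(G)\cup V(H)$ (in the disjoint union) until it stabilizes. (3) If the multisets of colors in $G$ and $H$ are different, decide that $G$ and $H$ are not isomorphic. (4) If all vertices of $G$ (equivalently of $H$) are colored uniquely (within that graph), decide that $G$ and $H$ are isomorphic. (5) Choose a color class with at least two vertices in both $G$ and $H$, select $v\in V(G)$ and $w\in V(H)$ in this class and give them the same new unique color. Repeat from step (2). A graph $G$ has the Tinhofer property if this algorithm gives the correct answer (whether $G\cong H$) for every graph $H$ and every choice of color classes and vertices in step (5). *)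

theory Defs
  imports
    "Graph_Theory.Graph_Theory"
    "HOL-Algebra.Elementary_Groups"
    "HOL-Library.Multiset"
    "HOL-Computational_Algebra.Primes"
begin

text \<open>
  Finite loop-free directed graphs are the records \<^typ>\<open>'a pair_pre_digraph\<close>
  satisfying \<^const>\<open>pair_digraph\<close>.
\<close>

definition cayley_graph :: "('a, 'm) monoid_scheme \<Rightarrow> 'a set \<Rightarrow> 'a pair_pre_digraph" where
  "cayley_graph A S =
    \<lparr> pverts = carrier A, parcs = {(h, s \<otimes>\<^bsub>A\<^esub> h) | h s. h \<in> carrier A \<and> s \<in> S} \<rparr>"

definition circulant_graph :: "nat \<Rightarrow> int pair_pre_digraph \<Rightarrow> bool" where
  "circulant_graph n G \<longleftrightarrow>
    (\<exists>S \<subseteq> carrier (integer_mod_group n) - {\<one>\<^bsub>integer_mod_group n\<^esub>}.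
      G = cayley_graph (integer_mod_group n) S)"

definition disjoint_union ::
    "'a pair_pre_digraph \<Rightarrow> 'b pair_pre_digraph \<Rightarrow> ('a + 'b) pair_pre_digraph" where
  "disjoint_union G H =
    \<lparr> pverts = pverts G <+> pverts H,
      parcs = map_prod Inl Inl ` parcs G \<union> map_prod Inr Inr ` parcs H \<rparr>"

definition graph_isomorphic :: "'a pair_pre_digraph \<Rightarrow> 'b pair_pre_digraph \<Rightarrow> bool" where
  "graph_isomorphic G H \<longleftrightarrow> digraph_iso (with_proj G) (with_proj H)"


text \<open>
  A coloring is a function to \<^typ>\<open>nat\<close>, of which only the values on the vertices matter.
  The names of the colors after a refinement step are left open: only the partition of the
  vertices into color classes is prescribed.
\<close>

type_synonym 'v coloring = "'v \<Rightarrow> nat"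

definition in_neighbor_colors :: "'v pair_pre_digraph \<Rightarrow> 'v coloring \<Rightarrow> 'v \<Rightarrow> nat multiset" where
  "in_neighbor_colors X c v = image_mset c (mset_set {h \<in> pverts X. (h, v) \<in> parcs X})"

definition refinement_step :: "'v pair_pre_digraph \<Rightarrow> 'v coloring \<Rightarrow> 'v coloring \<Rightarrow> bool" where
  "refinement_step X c c' \<longleftrightarrow>
    (\<forall>v \<in> pverts X. \<forall>v' \<in> pverts X.
      c' v = c' v' \<longleftrightarrow>
        c v = c v' \<and> in_neighbor_colors X c v = in_neighbor_colors X c v')"

definition same_partition :: "'v pair_pre_digraph \<Rightarrow> 'v coloring \<Rightarrow> 'v coloring \<Rightarrow> bool" where
  "same_partition X c c' \<longleftrightarrow>
    (\<forall>v \<in> pverts X. \<forall>v' \<in> pverts X. c v = c v' \<longleftrightarrow> c' v = c' v')"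

definition stable :: "'v pair_pre_digraph \<Rightarrow> 'v coloring \<Rightarrow> bool" where
  "stable X c \<longleftrightarrow> (\<forall>c'. refinement_step X c c' \<longrightarrow> same_partition X c c')"


definition color_multisets_agree ::
    "'a pair_pre_digraph \<Rightarrow> 'b pair_pre_digraph \<Rightarrow> ('a + 'b) coloring \<Rightarrow> bool" where
  "color_multisets_agree G H c \<longleftrightarrow>
    image_mset (c \<circ> Inl) (mset_set (pverts G)) = image_mset (c \<circ> Inr) (mset_set (pverts H))"

text \<open>
  \<open>Answer True\<close> is the decision ``isomorphic'', \<open>Answer False\<close> the decision
  ``not isomorphic''.
\<close>

datatype 'v tinhofer_config = Running "'v coloring" | Answer bool

inductive tinhofer_step ::
    "'a pair_pre_digraph \<Rightarrow> 'b pair_pre_digraph \<Rightarrow>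
      ('a + 'b) tinhofer_config \<Rightarrow> ('a + 'b) tinhofer_config \<Rightarrow> bool"
  for G :: "'a pair_pre_digraph" and H :: "'b pair_pre_digraph" where
  refine:
    "tinhofer_step G H (Running c) (Running c')"
    if "\<not> stable (disjoint_union G H) c"
      and "refinement_step (disjoint_union G H) c c'"
| reject:
    "tinhofer_step G H (Running c) (Answer False)"
    if "stable (disjoint_union G H) c"
      and "\<not> color_multisets_agree G H c"
| accept:
    "tinhofer_step G H (Running c) (Answer True)"
    if "stable (disjoint_union G H) c"
      and "color_multisets_agree G H c"
      and "inj_on (c \<circ> Inl) (pverts G)"
| individualize:
    "tinhofer_step G H (Running c) (Running (c(Inl v := k, Inr w := k)))"
    if "stable (disjoint_union G H) c"
      and "color_multisets_agree G H c"
      and "\<not> inj_on (c \<circ> Inl) (pverts G)"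
      and "v \<in> pverts G" and "w \<in> pverts H" and "c (Inl v) = c (Inr w)"
      and "card {x \<in> pverts G. c (Inl x) = c (Inl v)} \<ge> 2"
      and "card {y \<in> pverts H. c (Inr y) = c (Inr w)} \<ge> 2"
      and "k \<notin> c ` pverts (disjoint_union G H)"

text \<open>
  The algorithm gives the correct answer for all choices: no run is infinite (accessibility
  of the start configuration along reversed steps), and every run that cannot be continued
  has ended with the correct decision.
\<close>

definition tinhofer_correct :: "'a pair_pre_digraph \<Rightarrow> 'b pair_pre_digraph \<Rightarrow> bool" where
  "tinhofer_correct G H \<longleftrightarrow>
    Wellfounded.accp (tinhofer_step G H)\<inverse>\<inverse> (Running (\<lambda>_. 0)) \<and>
    (\<forall>s. (tinhofer_step G H)\<^sup>*\<^sup>* (Running (\<lambda>_. 0)) s \<and> (\<nexists>s'. tinhofer_step G H s s') \<longrightarrow>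
      s = Answer (graph_isomorphic G H))"

text \<open>
  The second graph ranges over all graphs with vertices in an arbitrary type, which has to
  be passed as a parameter.
\<close>

definition tinhofer_property :: "'b itself \<Rightarrow> 'a pair_pre_digraph \<Rightarrow> bool" where
  "tinhofer_property TYPE('b) G \<longleftrightarrow>
    pair_digraph G \<and> (\<forall>H :: 'b pair_pre_digraph. pair_digraph H \<longrightarrow> tinhofer_correct G H)"

end

theory Submission
  imports Defs "HOL-Number_Theory.Residues" "HOL-Computational_Algebra.Polynomial"
begin

text \<open>
  Acceptance is always justified: a stable coloring that is discrete on both graphs matches
  equally colored vertices, and equal multisets of in-neighbor colors make this matching an
  isomorphism.  Rejection has to be excluded when the graphs are isomorphic.  Refinement
  preserves every color-preserving isomorphism \<open>\<phi>\<close>.  Individualizing \<open>v\<close> and \<open>w\<close> destroys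
  \<open>\<phi>\<close> unless \<open>\<phi> v = w\<close>, but \<open>\<phi>\<close> can be corrected by a color-preserving automorphism of
  the first graph that moves \<open>v\<close> to the preimage of \<open>w\<close>.  Hence the property follows once
  each color class, for every stable coloring that can arise on the first graph, is an orbit of
  its color-preserving automorphisms (\<open>tinhofer_property_criterion\<close>).

  Let the graph be the circulant graph of prime order \<open>p\<close> with connection set \<open>S\<close>.  If \<open>S\<close> is
  empty or contains every nonzero residue, all permutations are automorphisms.  Otherwise the
  coloring is either constant, where the translations act transitively, or has a singleton
  class, which a translation moves to \<open>0\<close>.  For the latter case consider the polynomials over
  the field with \<open>p\<close> elements, of degree below \<open>p\<close>, that are constant on color classes.  They are
  closed under products of small degree and, by stability, under \<open>f \<mapsto> (\<Sum>s\<in>S. f (X - s))\<close>;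
  as \<open>{0}\<close> is a class, \<open>X ^ (p - 1)\<close> is among them.  Let \<open>d > 0\<close> be least such that the sum of
  the \<open>d\<close>-th powers over \<open>S\<close> is nonzero.  Subtracting \<open>card S * f\<close> from the convolution gives an
  operator that lowers degrees by exactly \<open>d\<close>.  Therefore the least positive degree \<open>e\<close> that
  occurs divides all degrees that occur, and each of these polynomials is a polynomial in a
  fixed one, \<open>g\<close>, of degree \<open>e\<close>.  Comparing the lowest terms in \<open>X ^ (p - 1) = q (g)\<close> forces \<open>g\<close>
  to be \<open>X ^ e\<close> up to a factor and an additive constant.

  So equally colored points have the same \<open>e\<close>-th power, that is, they differ by a factor \<open>m\<close> with
  \<open>m ^ e = 1\<close>.  Conversely, every such \<open>m\<close> fixes all polynomials in \<open>X ^ e\<close>, in particular the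
  indicator functions of the color classes and of \<open>S\<close>; multiplication by \<open>m\<close> is then a
  color-preserving automorphism.  The color classes are exactly the orbits of these
  multiplications (\<open>color_class_multiplier\<close>).
\<close>

section \<open>Degrees and orders of integer polynomials modulo a prime\<close>

text \<open>
  As \<open>p\<close> is a term, no type can depend on it, in particular not the field with \<open>p\<close> elements.
  Polynomials over this field are therefore represented by integer polynomials, whose degree
  and order (the exponent of the lowest term) ignore coefficients divisible by \<open>p\<close>.
\<close>

definition has_degree_mod :: "int \<Rightarrow> int poly \<Rightarrow> nat \<Rightarrow> bool" where
  "has_degree_mod p f k \<longleftrightarrow> \<not> p dvd coeff f k \<and> (\<forall>i>k. p dvd coeff f i)"

definition has_order_mod :: "int \<Rightarrow> int poly \<Rightarrow> nat \<Rightarrow> bool" where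
  "has_order_mod p f k \<longleftrightarrow> \<not> p dvd coeff f k \<and> (\<forall>i<k. p dvd coeff f i)"

lemma dvd_sum_iff_dvd_term:
  fixes t :: "'i \<Rightarrow> int"
  assumes "finite A" "a \<in> A" "\<And>i. i \<in> A \<Longrightarrow> i \<noteq> a \<Longrightarrow> p dvd t i"
  shows "p dvd sum t A \<longleftrightarrow> p dvd t a"
proof -
  have "p dvd sum t (A - {a})"
    using assms(3) by (intro dvd_sum) auto
  moreover have "sum t A = t a + sum t (A - {a})"
    using assms by (simp add: sum.remove)
  ultimately show ?thesis
    by (metis dvd_add_left_iff)
qed

lemma has_degree_mod_mult:
  assumes p: "Factorial_Ring.prime p" and f: "has_degree_mod p f k" and g: "has_degree_mod p g l"
  shows "has_degree_mod p (f * g) (k + l)"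
  unfolding has_degree_mod_def
proof (intro conjI allI impI)
  have "p dvd (\<Sum>i\<le>k + l. coeff f i * coeff g (k + l - i)) \<longleftrightarrow> p dvd coeff f k * coeff g (k + l - k)"
  proof (rule dvd_sum_iff_dvd_term)
    fix i assume "i \<in> {..k + l}" "i \<noteq> k"
    then have "i > k \<or> k + l - i > l" by auto
    then show "p dvd coeff f i * coeff g (k + l - i)"
      using f g by (auto simp: has_degree_mod_def)
  qed auto
  then show "\<not> p dvd coeff (f * g) (k + l)"
    using f g p by (simp add: coeff_mult has_degree_mod_def prime_dvd_mult_iff)
next
  fix i assume i: "k + l < i"
  show "p dvd coeff (f * g) i"
    unfolding coeff_mult
  proof (rule dvd_sum)
    fix j assume "j \<in> {..i}"
    with i have "j > k \<or> i - j > l" by auto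
    then show "p dvd coeff f j * coeff g (i - j)"
      using f g by (auto simp: has_degree_mod_def)
  qed
qed

lemma has_order_mod_mult:
  assumes p: "Factorial_Ring.prime p" and f: "has_order_mod p f k" and g: "has_order_mod p g l"
  shows "has_order_mod p (f * g) (k + l)"
  unfolding has_order_mod_def
proof (intro conjI allI impI)
  have "p dvd (\<Sum>i\<le>k + l. coeff f i * coeff g (k + l - i)) \<longleftrightarrow> p dvd coeff f k * coeff g (k + l - k)"
  proof (rule dvd_sum_iff_dvd_term)
    fix i assume "i \<in> {..k + l}" "i \<noteq> k"
    then have "i < k \<or> k + l - i < l" by auto
    then show "p dvd coeff f i * coeff g (k + l - i)"
      using f g by (auto simp: has_order_mod_def)
  qed auto
  then show "\<not> p dvd coeff (f * g) (k + l)"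
    using f g p by (simp add: coeff_mult has_order_mod_def prime_dvd_mult_iff)
next
  fix i assume i: "i < k + l"
  show "p dvd coeff (f * g) i"
    unfolding coeff_mult
  proof (rule dvd_sum)
    fix j assume "j \<in> {..i}"
    with i have "j < k \<or> i - j < l" by auto
    then show "p dvd coeff f j * coeff g (i - j)"
      using f g by (auto simp: has_order_mod_def)
  qed
qed

lemma has_degree_mod_power:
  assumes "Factorial_Ring.prime p" "has_degree_mod p f k"
  shows "has_degree_mod p (f ^ j) (k * j)"
proof (induction j)
  case 0
  show ?case
    using assms(1) not_prime_unit[of p] by (auto simp: has_degree_mod_def coeff_eq_0)
next
  case (Suc j)
  then show ?case
    using has_degree_mod_mult[OF assms(1,2) Suc] by simp
qed

lemma has_order_mod_power:
  assumes "Factorial_Ring.prime p" "has_order_mod p f k"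
  shows "has_order_mod p (f ^ j) (k * j)"
proof (induction j)
  case 0
  show ?case
    using assms(1) not_prime_unit[of p] by (auto simp: has_order_mod_def)
next
  case (Suc j)
  then show ?case
    using has_order_mod_mult[OF assms(1,2) Suc] by simp
qed

lemma pcompose_monom:
  fixes q :: "int poly"
  shows "pcompose (monom c i) q = smult c (q ^ i)"
  by (simp add: pcompose_altdef map_poly_monom poly_monom)

lemma coeff_pcompose_shift:
  fixes f :: "int poly"
  shows "coeff (pcompose f [:- s, 1:]) m
    = (\<Sum>i\<le>degree f. coeff f i * (of_nat (i choose m) * (- s) ^ (i - m)))"
proof -
  have "pcompose f [:- s, 1:] = pcompose (\<Sum>i\<le>degree f. monom (coeff f i) i) [:- s, 1:]"
    by (simp only: poly_as_sum_of_monoms)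
  also have "\<dots> = (\<Sum>i\<le>degree f. smult (coeff f i) ([:- s, 1:] ^ i))"
    by (simp only: pcompose_sum pcompose_monom)
  finally have *: "pcompose f [:- s, 1:] = (\<Sum>i\<le>degree f. smult (coeff f i) ([:- s, 1:] ^ i))" .
  have "coeff ([:- s, 1:] ^ i) m = of_nat (i choose m) * (- s) ^ (i - m)" for i
    by (cases "m \<le> i") (simp_all add: coeff_linear_poly_power coeff_eq_0 degree_linear_power)
  then show ?thesis
    unfolding * by (simp add: coeff_sum)
qed

lemma fermat_theorem_int:
  fixes p :: nat and x :: int
  assumes "Factorial_Ring.prime p" "\<not> int p dvd x"
  shows "[x ^ (p - 1) = 1] (mod int p)"
proof -
  have p: "p > 0" using assms(1) prime_gt_0_nat by blast
  define a where "a = nat (x mod int p)"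
  have a: "int a = x mod int p" using p by (simp add: a_def)
  have "\<not> p dvd a"
    using assms(2) a by (metis dvd_mod_iff int_dvd_int_iff dvd_refl)
  then have "[a ^ (p - 1) = 1] (mod p)"
    using assms(1) fermat_theorem by blast
  then have "[int a ^ (p - 1) = 1] (mod int p)"
    by (metis cong_int_iff of_nat_1 of_nat_power)
  then show ?thesis
    unfolding a by (simp add: cong_def power_mod)
qed

section \<open>Sets of degrees closed under addition and a shift\<close>

text \<open>
  Subtracting \<open>d\<close> repeatedly from \<open>n\<close> shows that the least positive element \<open>e\<close> satisfies
  \<open>e \<le> d\<close> and \<open>d + e \<le> n\<close>.  From any element \<open>f \<le> d\<close>, steps of length \<open>e\<close> therefore reach the
  interval from \<open>d\<close> to \<open>d + e - 1\<close> without leaving the admissible range; after subtracting \<open>d\<close>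
  the result is below \<open>e\<close>, hence zero.  So \<open>d - f\<close> is a multiple of \<open>e\<close>.
\<close>

lemma least_positive_degree_divides:
  fixes E :: "nat set"
  assumes n: "n \<in> E" and le: "\<And>k. k \<in> E \<Longrightarrow> k \<le> n"
    and add: "\<And>a b. a \<in> E \<Longrightarrow> b \<in> E \<Longrightarrow> a + b \<le> n \<Longrightarrow> a + b \<in> E"
    and sub: "\<And>a. a \<in> E \<Longrightarrow> d \<le> a \<Longrightarrow> a - d \<in> E"
    and d: "0 < d" "d < n"
  obtains e where "e \<in> E" "0 < e" "\<And>k. k \<in> E \<Longrightarrow> e dvd k"
proof -
  define e where "e = (LEAST k. k \<in> E \<and> 0 < k)"
  have e: "e \<in> E" "0 < e"
    using LeastI[of "\<lambda>k. k \<in> E \<and> 0 < k" n] n d unfolding e_def by auto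
  have e_min: "k = 0" if "k \<in> E" "k < e" for k
    using not_less_Least[of k "\<lambda>k. k \<in> E \<and> 0 < k"] that unfolding e_def by auto
  have sub_mult: "n - q * d \<in> E" if "q * d \<le> n" for q
    using that
  proof (induction q)
    case (Suc q)
    then have "n - q * d \<in> E" "d \<le> n - q * d" by auto
    then have "n - q * d - d \<in> E" by (rule sub)
    then show ?case by (simp add: diff_diff_add add.commute)
  qed (use n in simp)
  have bound: "e \<le> d \<and> d + e \<le> n"
  proof (cases "n mod d = 0")
    case False
    have "n - (n div d) * d \<in> E"
      by (rule sub_mult) simp
    then have "n mod d \<in> E"
      by (simp add: minus_div_mult_eq_mod)
    then have "e \<le> n mod d"
      using e_min[of "n mod d"] False by (meson not_le)
    moreover have "n mod d < d"
      using d by simp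
    moreover have "d + n mod d \<le> n"
      using d le_mod_geq[of d n] mod_less_eq_dividend[of "n - d" d] by linarith
    ultimately show ?thesis by simp
  next
    case True
    then obtain q where q: "n = d * q" by auto
    with d have q2: "2 \<le> q" by (cases q rule: nat.exhaust; cases "q = 1") auto
    then have "n - (q - 1) * d = d"
      unfolding q by (simp add: algebra_simps diff_mult_distrib2)
    then have "d \<in> E"
      using sub_mult[of "q - 1"] q by simp
    then have "e \<le> d" using e_min[of d] d by force
    moreover have "2 * d \<le> n" unfolding q using q2 by simp
    ultimately show ?thesis by simp
  qed
  have mult: "f + j * e \<in> E" if "f \<in> E" "f + j * e \<le> n" for f j
    using that(2)
  proof (induction j)
    case (Suc j)
    then show ?case using add[of "f + j * e" e] e by (simp add: ac_simps)
  qed (use that in simp)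
  have reach: "\<exists>j. f + j * e = d" if f: "f \<in> E" "f \<le> d" for f
  proof -
    \<comment> \<open>The number of steps is \<open>(d - f) / e\<close>, rounded up.\<close>
    define j where "j = (d - f + e - 1) div e"
    have j: "d - f \<le> j * e" "j * e < d - f + e"
    proof -
      have "(d - f + e - 1) div e * e + (d - f + e - 1) mod e = d - f + e - 1" by simp
      moreover have "(d - f + e - 1) mod e \<le> e - 1" using e(2)
        by (metis Suc_diff_1 less_Suc_eq_le mod_less_divisor)
      ultimately show "d - f \<le> j * e" "j * e < d - f + e" unfolding j_def using e(2) by linarith+
    qed
    have "f + j * e \<in> E" using j f bound by (intro mult) auto
    then have "f + j * e - d \<in> E" using j f by (intro sub) auto
    then have "f + j * e - d = 0" using j f by (intro e_min) auto
    then show ?thesis using j f by (intro exI[of _ j]) linarith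
  qed
  obtain j where "e + j * e = d"
    using reach[of e] e bound by blast
  then have ed: "e dvd d"
    by (metis dvd_add_right_iff dvd_refl dvd_triv_right)
  have "e dvd k" if "k \<in> E" for k
    using that
  proof (induction k rule: less_induct)
    case (less k)
    show ?case
    proof (cases "k \<le> d")
      case True
      then obtain j where "k + j * e = d" using reach less by blast
      then show ?thesis using ed by (metis dvd_add_left_iff dvd_triv_right)
    next
      case False
      then have "e dvd k - d" using less sub[of k] d by simp
      then show ?thesis using ed False by (metis dvd_diffD1 dvd_diffD nle_le)
    qed
  qed
  then show ?thesis using that e by blast
qed

section \<open>Stable colorings with a singleton class\<close>

text \<open>
  \<open>C\<close> is a stable coloring of the residues modulo \<open>p\<close>, extended periodically to the integers,
  for which \<open>{0}\<close> is a color class.  The in-neighbors of \<open>x\<close> in the circulant graph with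
  connection set \<open>S\<close> are the points \<open>x - s\<close>.  Only the connection sets of the empty and of the
  complete graph are excluded.
\<close>

locale pointed_stable_coloring =
  fixes p :: nat and S :: "int set" and C :: "int \<Rightarrow> nat"
  assumes prime_p: "Factorial_Ring.prime p"
    and S_subset: "S \<subseteq> {1..<int p}"
    and S_nonempty: "S \<noteq> {}"
    and S_proper: "S \<noteq> {1..<int p}"
    and periodic: "[x = y] (mod int p) \<Longrightarrow> C x = C y"
    and equitable: "C x = C y \<Longrightarrow>
      image_mset (\<lambda>s. C (x - s)) (mset_set S) = image_mset (\<lambda>s. C (y - s)) (mset_set S)"
    and zero_class: "C x = C 0 \<Longrightarrow> int p dvd x"
begin

definition color_poly :: "int poly \<Rightarrow> bool" where
  "color_poly f \<longleftrightarrow> (\<forall>x y. C x = C y \<longrightarrow> [poly f x = poly f y] (mod int p))"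

definition color_degree :: "nat \<Rightarrow> bool" where
  "color_degree k \<longleftrightarrow> k < p \<and> (\<exists>f. color_poly f \<and> has_degree_mod (int p) f k)"

text \<open>
  Power sums of the connection set; their vanishing modulo \<open>p\<close> determines how far the
  convolution with \<open>S\<close> lowers degrees.
\<close>

definition moment :: "nat \<Rightarrow> int" where
  "moment j = (\<Sum>s\<in>S. s ^ j)"

text \<open>
  By Fermat's little theorem, \<open>1 - (x - a) ^ (p - 1)\<close> is the indicator of \<open>x = a\<close> modulo \<open>p\<close>.
\<close>

definition indicator_poly :: "int set \<Rightarrow> int poly" where
  "indicator_poly A = (\<Sum>a\<in>A. 1 - [:- a, 1:] ^ (p - 1))"

lemma p_gt_1: "1 < p"
  using prime_p prime_gt_1_nat by blast

lemma prime_int_p: "Factorial_Ring.prime (int p)"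
  using prime_p by simp

lemma coprime_int_p: "\<not> int p dvd a \<Longrightarrow> coprime a (int p)"
  using prime_imp_coprime[OF prime_int_p] coprime_commute by blast

lemma color_poly_const: "color_poly [:a:]"
  by (simp add: color_poly_def)

lemma color_poly_diff: "color_poly f \<Longrightarrow> color_poly g \<Longrightarrow> color_poly (f - g)"
  by (simp add: color_poly_def cong_diff)

lemma color_poly_mult: "color_poly f \<Longrightarrow> color_poly g \<Longrightarrow> color_poly (f * g)"
  by (simp add: color_poly_def cong_mult)

lemma color_poly_smult: "color_poly f \<Longrightarrow> color_poly (smult a f)"
  by (simp add: color_poly_def cong_scalar_left)

lemma color_poly_power: "color_poly f \<Longrightarrow> color_poly (f ^ j)"
  by (simp add: color_poly_def cong_pow)

text \<open>
  The form in which stability is used: convolution with the indicator of \<open>S\<close> preserves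
  functions that are constant on color classes.
\<close>

lemma equitable_sum:
  assumes h: "\<And>u v. C u = C v \<Longrightarrow> [h u = h v] (mod int p)" and xy: "C x = C y"
  shows "[(\<Sum>s\<in>S. h (x - s)) = (\<Sum>s\<in>S. h (y - s))] (mod int p)"
proof -
  define h' :: "nat \<Rightarrow> int" where "h' k = h (SOME u. C u = k)" for k
  have h': "[h u = h' (C u)] (mod int p)" for u
    unfolding h'_def by (rule h, rule sym, rule someI[of "\<lambda>v. C v = C u" u]) (rule refl)
  have "[(\<Sum>s\<in>S. h (z - s)) = (\<Sum>s\<in>S. h' (C (z - s)))] (mod int p)" for z
    by (rule cong_sum) (rule h')
  moreover have "(\<Sum>s\<in>S. h' (C (x - s))) = (\<Sum>s\<in>S. h' (C (y - s)))"
  proof -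
    have "(\<Sum>s\<in>S. h' (C (z - s)))
        = sum_mset (image_mset h' (image_mset (\<lambda>s. C (z - s)) (mset_set S)))" for z
      by (simp add: sum_unfold_sum_mset multiset.map_comp comp_def)
    then show ?thesis
      using equitable[OF xy] by simp
  qed
  ultimately show ?thesis
    by (metis cong_sym cong_trans)
qed

lemma zero_class_iff:
  assumes "C u = C v"
  shows "int p dvd u \<longleftrightarrow> int p dvd v"
proof -
  have "C z = C 0 \<longleftrightarrow> int p dvd z" for z
    using periodic[of z 0] zero_class[of z] unfolding cong_0_iff by blast
  then show ?thesis
    using assms by metis
qed

lemma fermat_indicator:
  "[1 - x ^ (p - 1) = (if int p dvd x then 1 else 0)] (mod int p)"
proof (cases "int p dvd x")
  case True
  then have "int p dvd x ^ (p - 1)"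
    using p_gt_1 by (intro dvd_trans[OF _ dvd_power]) auto
  then have "[1 - x ^ (p - 1) = 1 - 0] (mod int p)"
    by (intro cong_diff) (simp_all add: cong_0_iff)
  then show ?thesis
    using True by simp
next
  case False
  then have "[x ^ (p - 1) = 1] (mod int p)"
    using fermat_theorem_int prime_p by blast
  then show ?thesis
    using False cong_diff[OF cong_refl[of 1], of "x ^ (p - 1)" 1 "int p"] by simp
qed

lemma fermat_indicator_cong:
  assumes "C u = C v"
  shows "[1 - u ^ (p - 1) = 1 - v ^ (p - 1)] (mod int p)"
  using fermat_indicator[of u] cong_sym[OF fermat_indicator[of v]]
  unfolding zero_class_iff[OF assms] by (rule cong_trans)

lemma color_poly_monom_p_minus_1: "color_poly (monom 1 (p - 1))"
proof -
  have "[u ^ (p - 1) = v ^ (p - 1)] (mod int p)" if "C u = C v" for u v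
    using cong_diff[OF cong_refl[of 1] fermat_indicator_cong[OF that]] by simp
  then show ?thesis
    by (simp add: color_poly_def poly_monom)
qed

lemma poly_indicator_poly:
  "poly (indicator_poly A) x = (\<Sum>a\<in>A. 1 - (x - a) ^ (p - 1))"
  by (simp add: indicator_poly_def poly_sum)

lemma indicator_poly_low_degree:
  assumes "p \<le> i"
  shows "coeff (indicator_poly A) i = 0"
proof -
  have "coeff ([:- a, 1:] ^ (p - 1)) i = 0" for a :: int
    by (rule coeff_eq_0) (use assms p_gt_1 in \<open>simp add: degree_linear_power\<close>)
  moreover have "coeff (1 :: int poly) i = 0"
    by (rule coeff_eq_0) (use assms p_gt_1 in simp)
  ultimately show ?thesis
    by (simp add: indicator_poly_def coeff_sum)
qed

lemma indicator_cong_iff: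
  assumes "[a = (if P then 1 else 0)] (mod int p)" "[b = (if Q then 1 else 0)] (mod int p)"
    and "[a = b] (mod int p)"
  shows "P \<longleftrightarrow> Q"
proof -
  have "[(if P then 1 else 0) = (if Q then 1 else 0 :: int)] (mod int p)"
    using cong_trans[OF cong_trans[OF cong_sym[OF assms(1)] assms(3)] assms(2)] .
  moreover have "\<not> [1 = 0 :: int] (mod int p)" "\<not> [0 = 1 :: int] (mod int p)"
    using p_gt_1 by (auto simp: cong_def)
  ultimately show ?thesis by (cases P; cases Q) simp_all
qed

lemma indicator_poly_cong:
  assumes A: "A \<subseteq> {0..<int p}"
  shows "[poly (indicator_poly A) x = (if x mod int p \<in> A then 1 else 0)] (mod int p)"
proof -
  have "[poly (indicator_poly A) x = (\<Sum>a\<in>A. if x mod int p = a then 1 else 0)] (mod int p)"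
    unfolding poly_indicator_poly
  proof (rule cong_sum)
    fix a assume "a \<in> A"
    then have "a mod int p = a" using A by auto
    then have "int p dvd x - a \<longleftrightarrow> x mod int p = a"
      by (metis mod_eq_dvd_iff)
    then show "[1 - (x - a) ^ (p - 1) = (if x mod int p = a then 1 else 0)] (mod int p)"
      using fermat_indicator[of "x - a"] by simp
  qed
  moreover have "finite A" using A finite_subset by blast
  ultimately show ?thesis by (simp add: sum.delta)
qed

text \<open>
  The indicator of \<open>S\<close> is the convolution of \<open>S\<close> with the indicator of the color class \<open>{0}\<close>.
\<close>

lemma color_poly_indicator_S: "color_poly (indicator_poly S)"
  unfolding color_poly_def poly_indicator_poly
  using equitable_sum[of "\<lambda>u. 1 - u ^ (p - 1)"] fermat_indicator_cong by blast

lemma indicator_class_cong: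
  "[poly (indicator_poly {a \<in> {0..<int p}. C a = k}) x = (if C x = k then 1 else 0)] (mod int p)"
proof -
  have "C (x mod int p) = C x"
    by (rule periodic) (simp add: cong_def)
  then have mem: "x mod int p \<in> {a \<in> {0..<int p}. C a = k} \<longleftrightarrow> C x = k"
    using p_gt_1 by simp
  have "{a \<in> {0..<int p}. C a = k} \<subseteq> {0..<int p}"
    by blast
  from indicator_poly_cong[OF this, of x] show ?thesis
    unfolding mem .
qed

lemma color_poly_indicator_class: "color_poly (indicator_poly {a \<in> {0..<int p}. C a = k})"
  unfolding color_poly_def
proof (intro allI impI)
  fix x y assume xy: "C x = C y"
  show "[poly (indicator_poly {a \<in> {0..<int p}. C a = k}) x
    = poly (indicator_poly {a \<in> {0..<int p}. C a = k}) y] (mod int p)"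
    using indicator_class_cong[of k x] cong_sym[OF indicator_class_cong[of k y]]
    unfolding xy by (rule cong_trans)
qed

text \<open>
  If all power sums with exponents strictly between \<open>0\<close> and \<open>p - 1\<close> vanished, expanding
  \<open>(x - s) ^ (p - 1)\<close> would show that the indicator of \<open>S\<close> is constant on nonzero residues.
\<close>

lemma nonzero_moment:
  obtains d where "0 < d" "d < p - 1" "\<not> int p dvd moment d"
    "\<And>j. 0 < j \<Longrightarrow> j < d \<Longrightarrow> int p dvd moment j"
proof -
  have "\<exists>d. 0 < d \<and> d < p - 1 \<and> \<not> int p dvd moment d"
  proof (rule ccontr)
    assume "\<not> ?thesis"
    then have zero: "int p dvd moment j" if "0 < j" "j < p - 1" for j
      using that by blast
    define n where "n = p - 1"
    have n: "0 < n" using p_gt_1 by (simp add: n_def)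
    define K where "K = moment 0 + (- 1) ^ n * moment n"
    have K: "[(\<Sum>s\<in>S. (x - s) ^ n) = K] (mod int p)" if "\<not> int p dvd x" for x
    proof -
      have "(x - s) ^ n = (\<Sum>k\<le>n. of_nat (n choose k) * (- s) ^ k * x ^ (n - k))" for s
        unfolding binomial_ring[of "- s" x n, symmetric] by simp
      then have "(\<Sum>s\<in>S. (x - s) ^ n)
          = (\<Sum>s\<in>S. \<Sum>k\<le>n. of_nat (n choose k) * (- s) ^ k * x ^ (n - k))"
        by simp
      also have "\<dots> = (\<Sum>k\<le>n. \<Sum>s\<in>S. of_nat (n choose k) * (- s) ^ k * x ^ (n - k))"
        by (rule sum.swap)
      also have "\<dots> = (\<Sum>k\<le>n. of_nat (n choose k) * (- 1) ^ k * x ^ (n - k) * moment k)"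
        unfolding moment_def sum_distrib_left
        by (intro sum.cong refl) (subst power_minus, simp add: mult_ac)
      also have "[\<dots> = (\<Sum>k\<le>n. if k = 0 then x ^ n * moment 0 else
          if k = n then (- 1) ^ n * moment n else 0)] (mod int p)"
      proof (rule cong_sum)
        fix k assume "k \<in> {..n}"
        then consider "k = 0" | "k = n" "k \<noteq> 0" | "0 < k" "k < n" by fastforce
        then show "[of_nat (n choose k) * (- 1) ^ k * x ^ (n - k) * moment k =
          (if k = 0 then x ^ n * moment 0 else if k = n then (- 1) ^ n * moment n else 0)] (mod int p)"
        proof cases
          case 3
          then show ?thesis using zero[of k] by (simp add: cong_0_iff n_def)
        qed simp_all
      qed
      also have "(\<Sum>k\<le>n. if k = 0 then x ^ n * moment 0 else
          if k = n then (- 1) ^ n * moment n else 0) = x ^ n * moment 0 + (- 1) ^ n * moment n"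
      proof -
        have "(\<Sum>k\<le>n. if k = 0 then x ^ n * moment 0 else if k = n then (- 1) ^ n * moment n else 0)
          = (\<Sum>k\<le>n. (if k = 0 then x ^ n * moment 0 else 0) + (if k = n then (- 1) ^ n * moment n else 0))"
          using n by (intro sum.cong) auto
        then show ?thesis by (simp add: sum.distrib)
      qed
      also have "[x ^ n * moment 0 + (- 1) ^ n * moment n = 1 * moment 0 + (- 1) ^ n * moment n] (mod int p)"
        using fermat_theorem_int[OF prime_p that] unfolding n_def
        by (intro cong_add cong_mult) auto
      finally show ?thesis by (simp add: K_def)
    qed
    obtain a b where a: "a \<in> S" and b: "b \<in> {1..<int p}" "b \<notin> S"
      using S_nonempty S_proper S_subset by blast
    have ndvd: "\<not> int p dvd x" if "x \<in> {1..<int p}" for x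
      using that by (simp add: zdvd_not_zless)
    have ind: "[poly (indicator_poly S) x = moment 0 - K] (mod int p)" if "x \<in> {1..<int p}" for x
      unfolding poly_indicator_poly sum_subtractf
      using K[OF ndvd[OF that]] by (intro cong_diff) (simp_all add: moment_def n_def)
    have S0: "S \<subseteq> {0..<int p}" using S_subset by auto
    have "[poly (indicator_poly S) a = 1] (mod int p)" "[poly (indicator_poly S) b = 0] (mod int p)"
      using indicator_poly_cong[OF S0, of a] indicator_poly_cong[OF S0, of b] a b S_subset by auto
    moreover have "[poly (indicator_poly S) a = poly (indicator_poly S) b] (mod int p)"
      using ind[of a] ind[of b] a b S_subset by (metis cong_sym cong_trans subsetD)
    ultimately have "[1 = 0] (mod int p)" by (metis cong_sym cong_trans)
    then show False using p_gt_1 by (simp add: cong_0_iff)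
  qed
  then obtain d where d: "0 < d \<and> d < p - 1 \<and> \<not> int p dvd moment d"
    and least: "\<And>j. j < d \<Longrightarrow> \<not> (0 < j \<and> j < p - 1 \<and> \<not> int p dvd moment j)"
    using exists_least_iff[of "\<lambda>d. 0 < d \<and> d < p - 1 \<and> \<not> int p dvd moment d"] by blast
  show ?thesis
    by (rule that[of d]) (use d least in fastforce)+
qed

text \<open>
  Since \<open>moment 0\<close> is the cardinality of \<open>S\<close>, subtracting \<open>smult (moment 0) f\<close> cancels the
  leading term of the convolution.
\<close>

definition lowering :: "int poly \<Rightarrow> int poly" where
  "lowering f = (\<Sum>s\<in>S. pcompose f [:- s, 1:]) - smult (moment 0) f"

lemma color_poly_lowering:
  assumes "color_poly f"
  shows "color_poly (lowering f)"
  unfolding color_poly_def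
proof (intro allI impI)
  fix x y assume xy: "C x = C y"
  have *: "poly (lowering f) z = (\<Sum>s\<in>S. poly f (z - s)) - moment 0 * poly f z" for z
    by (simp add: lowering_def poly_sum poly_pcompose)
  show "[poly (lowering f) x = poly (lowering f) y] (mod int p)"
    unfolding *
    by (intro cong_diff cong_scalar_left equitable_sum[of "poly f", OF _ xy])
      (use assms xy in \<open>auto simp: color_poly_def\<close>)
qed

text \<open>
  In the Taylor expansion of \<open>\<Sum>s\<in>S. f (X - s)\<close> the \<open>j\<close>-th derivative of \<open>f\<close> comes with the factor
  \<open>moment j\<close>.  The term \<open>j = 0\<close> is cancelled and those with \<open>0 < j < d\<close> vanish.  The
  leading coefficient for \<open>j = d\<close> survives because the binomial coefficient \<open>k choose d\<close> with
  \<open>k < p\<close> is prime to \<open>p\<close>.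
\<close>

lemma has_degree_mod_lowering:
  assumes d: "0 < d" "\<not> int p dvd moment d" "\<And>j. 0 < j \<Longrightarrow> j < d \<Longrightarrow> int p dvd moment j"
    and f: "has_degree_mod (int p) f k" and k: "k < p" "d \<le> k"
  shows "has_degree_mod (int p) (lowering f) (k - d)"
proof -
  define t where "t m i = coeff f i * of_nat (i choose m) * (- 1) ^ (i - m) * moment (i - m)" for m i
  have coeff_low: "coeff (lowering f) m = (\<Sum>i\<le>degree f. if i = m then 0 else t m i)" for m
  proof -
    have "coeff (\<Sum>s\<in>S. pcompose f [:- s, 1:]) m
        = (\<Sum>s\<in>S. \<Sum>i\<le>degree f. coeff f i * (of_nat (i choose m) * (- s) ^ (i - m)))"
      by (simp add: coeff_sum coeff_pcompose_shift)
    also have "\<dots> = (\<Sum>i\<le>degree f. \<Sum>s\<in>S. coeff f i * (of_nat (i choose m) * (- s) ^ (i - m)))"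
      by (rule sum.swap)
    also have "\<dots> = (\<Sum>i\<le>degree f. t m i)"
      unfolding t_def moment_def sum_distrib_left
      by (intro sum.cong refl) (subst power_minus, simp add: mult_ac)
    also have "\<dots> = (\<Sum>i\<le>degree f. (if i = m then t m m else 0) + (if i = m then 0 else t m i))"
      by (intro sum.cong) auto
    also have "\<dots> = moment 0 * coeff f m + (\<Sum>i\<le>degree f. if i = m then 0 else t m i)"
      by (simp add: sum.distrib t_def coeff_eq_0)
    finally show ?thesis by (simp add: lowering_def)
  qed
  have t_dvd: "int p dvd t m i" if "k - d \<le> m" "i \<noteq> m" "i \<noteq> k \<or> m \<noteq> k - d" for m i
  proof -
    have "i < m \<or> k < i \<or> 0 < i - m \<and> i - m < d"
      using that k by arith
    then show ?thesis
      using f d by (auto simp: t_def has_degree_mod_def binomial_eq_0)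
  qed
  have "\<not> int p dvd t (k - d) k"
  proof -
    have "\<not> p dvd k choose (k - d)"
    proof -
      have "\<not> p dvd fact k" using k prime_p by (simp add: prime_dvd_fact_iff)
      moreover have "(k choose (k - d)) dvd fact k"
        using binomial_fact_lemma[of "k - d" k] by (metis diff_le_self dvd_triv_right)
      ultimately show ?thesis using dvd_trans by blast
    qed
    moreover have "\<not> int p dvd (- 1) ^ d"
      using p_gt_1 by (cases "even d") auto
    ultimately show ?thesis
      using f d k prime_int_p by (simp add: t_def has_degree_mod_def prime_dvd_mult_iff)
  qed
  moreover have "k \<le> degree f"
    using f by (intro le_degree) (auto simp: has_degree_mod_def intro: ccontr)
  then have "int p dvd coeff (lowering f) (k - d) \<longleftrightarrow> int p dvd (if k = k - d then 0 else t (k - d) k)"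
    unfolding coeff_low by (intro dvd_sum_iff_dvd_term) (auto intro: t_dvd)
  moreover have "int p dvd coeff (lowering f) m" if "m > k - d" for m
    unfolding coeff_low using that by (intro dvd_sum) (auto intro: t_dvd)
  ultimately show ?thesis
    using d k by (auto simp: has_degree_mod_def)
qed

lemma least_positive_color_degree:
  obtains e where "color_degree e" "0 < e" "\<And>k. color_degree k \<Longrightarrow> e dvd k"
proof -
  obtain d where d: "0 < d" "d < p - 1" "\<not> int p dvd moment d"
    "\<And>j. 0 < j \<Longrightarrow> j < d \<Longrightarrow> int p dvd moment j"
    using nonzero_moment by blast
  have top: "color_degree (p - 1)"
    unfolding color_degree_def
    using p_gt_1 color_poly_monom_p_minus_1
    by (auto intro!: exI[of _ "monom 1 (p - 1)"] simp: has_degree_mod_def)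
  have add: "color_degree (a + b)" if "color_degree a" "color_degree b" "a + b \<le> p - 1" for a b
    using that p_gt_1 has_degree_mod_mult[OF prime_int_p] color_poly_mult
    unfolding color_degree_def by (metis diff_less less_numeral_extra(1) order_le_less_trans order_less_trans zero_less_one)
  have sub: "color_degree (a - d)" if "color_degree a" "d \<le> a" for a
    using that has_degree_mod_lowering[OF d(1,3,4)] color_poly_lowering
    unfolding color_degree_def by (meson diff_le_self order_le_less_trans)
  obtain e where "e \<in> {k. color_degree k}" "0 < e" "\<And>k. k \<in> {k. color_degree k} \<Longrightarrow> e dvd k"
  proof (rule least_positive_degree_divides[of "p - 1" "{k. color_degree k}" d])
    show "k \<le> p - 1" if "k \<in> {k. color_degree k}" for k
      using that by (auto simp: color_degree_def)
  qed (use top add sub d in auto)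
  then show ?thesis using that by blast
qed

text \<open>
  Division with respect to powers of \<open>g\<close>: as \<open>e\<close> divides the degree of \<open>f\<close>, a multiple of a power
  of \<open>g\<close> cancels the leading term of \<open>f\<close>.  The bound on the degree of \<open>q\<close> is what makes the
  comparison of lowest terms in \<open>X ^ (p - 1) = q (g)\<close> conclusive.
\<close>

lemma color_poly_expansion:
  assumes div: "\<And>k. color_degree k \<Longrightarrow> e dvd k"
    and g: "color_poly g" "has_degree_mod (int p) g e"
    and "color_poly f" "\<And>i. n \<le> i \<Longrightarrow> int p dvd coeff f i" "n \<le> p"
  shows "\<exists>q. (\<forall>i. int p dvd coeff (f - pcompose q g) i) \<and> (\<forall>j. n \<le> j * e \<longrightarrow> coeff q j = 0)"
  using assms(4-6)
proof (induction n arbitrary: f)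
  case 0
  then show ?case by (intro exI[of _ 0]) simp
next
  case (Suc n)
  show ?case
  proof (cases "int p dvd coeff f n")
    case True
    then have "\<exists>q. (\<forall>i. int p dvd coeff (f - pcompose q g) i) \<and> (\<forall>j. n \<le> j * e \<longrightarrow> coeff q j = 0)"
    proof (intro Suc.IH)
      show "int p dvd coeff f i" if "n \<le> i" for i
        using that True Suc.prems(2)[of i] by (cases "i = n") auto
    qed (use Suc.prems in auto)
    then show ?thesis by (meson Suc_leD)
  next
    case False
    then have "has_degree_mod (int p) f n"
      using Suc.prems by (simp add: has_degree_mod_def)
    then have "color_degree n"
      using Suc.prems by (auto simp: color_degree_def)
    then obtain j where j: "n = e * j" using div by blast
    have gj: "has_degree_mod (int p) (g ^ j) n"
      unfolding j by (rule has_degree_mod_power[OF prime_int_p g(2)])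
    then have "coprime (coeff (g ^ j) n) (int p)"
      by (intro coprime_int_p) (simp add: has_degree_mod_def)
    then obtain c where c: "[coeff (g ^ j) n * c = 1] (mod int p)"
      using cong_solve_coprime_int by blast
    define b where "b = coeff f n * c"
    define f' where "f' = f - smult b (g ^ j)"
    have "color_poly f'"
      unfolding f'_def using Suc.prems g by (intro color_poly_diff color_poly_smult color_poly_power)
    moreover have "int p dvd coeff f' i" if "n \<le> i" for i
    proof (cases "i = n")
      case True
      have "int p dvd coeff f n * (coeff (g ^ j) n * c - 1)"
        using c by (simp add: cong_iff_dvd_diff)
      moreover have "coeff f' n = - (coeff f n * (coeff (g ^ j) n * c - 1))"
        by (simp add: f'_def b_def algebra_simps)
      ultimately show ?thesis using True by simp
    next
      case False
      with that show ?thesis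
        using Suc.prems(2)[of i] gj by (simp add: f'_def has_degree_mod_def)
    qed
    ultimately obtain q where q: "\<forall>i. int p dvd coeff (f' - pcompose q g) i"
      "\<forall>j. n \<le> j * e \<longrightarrow> coeff q j = 0"
      using Suc.IH[of f'] Suc.prems(3) by auto
    have "f - pcompose (q + monom b j) g = f' - pcompose q g"
      by (simp add: f'_def pcompose_add pcompose_monom)
    moreover have "coeff (q + monom b j) i = 0" if "Suc n \<le> i * e" for i
    proof -
      have "i \<noteq> j" using that j by (auto simp: mult.commute)
      moreover have "coeff q i = 0" using that q(2) by simp
      ultimately show ?thesis by simp
    qed
    ultimately show ?thesis
      using q(1) by (intro exI[of _ "q + monom b j"]) simp
  qed
qed

text \<open>
  Let \<open>r\<close> be the order of a polynomial \<open>g\<close> of degree \<open>e\<close> without constant term, and \<open>t\<close> the order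
  of \<open>q\<close> in \<open>X ^ (p - 1) = q (g)\<close>.  The lowest term on the right has exponent \<open>r * t\<close>, so
  \<open>r * t = p - 1\<close>.  But \<open>t\<close> is at most the degree of \<open>q\<close>, so \<open>e * t \<le> p - 1\<close>.  Hence \<open>e \<le> r\<close>,
  which leaves only one term in \<open>g\<close>.
\<close>

lemma color_poly_monom_least_degree:
  assumes e: "color_degree e" "0 < e" and div: "\<And>k. color_degree k \<Longrightarrow> e dvd k"
  shows "color_poly (monom 1 e)"
proof -
  obtain g0 where g0: "color_poly g0" "has_degree_mod (int p) g0 e"
    using e by (auto simp: color_degree_def)
  define g where "g = g0 - [:coeff g0 0:]"
  have g: "color_poly g"
    unfolding g_def using g0 by (intro color_poly_diff color_poly_const)
  have g_deg: "has_degree_mod (int p) g e"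
    using g0(2) e(2) by (auto simp: g_def has_degree_mod_def coeff_pCons split: nat.splits)
  have g_0: "coeff g 0 = 0"
    by (simp add: g_def)
  obtain r where r: "has_order_mod (int p) g r"
    using g_deg exists_least_iff[of "\<lambda>i. \<not> int p dvd coeff g i"]
    unfolding has_order_mod_def has_degree_mod_def by blast
  have r_pos: "0 < r" using r g_0 by (cases r) (auto simp: has_order_mod_def)
  have r_le: "r \<le> e" using r g_deg by (meson has_degree_mod_def has_order_mod_def not_le)
  obtain q where q: "\<And>i. int p dvd coeff (monom 1 (p - 1) - pcompose q g) i"
      "\<And>j. p \<le> j * e \<Longrightarrow> coeff q j = 0"
  proof -
    have "int p dvd coeff (monom 1 (p - 1)) i" if "p \<le> i" for i
      using that p_gt_1 by auto
    from color_poly_expansion[OF div g g_deg color_poly_monom_p_minus_1 this order_refl]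
    show ?thesis using that by blast
  qed
  have expand: "coeff (pcompose q g) i = (\<Sum>j\<le>degree q. coeff q j * coeff (g ^ j) i)" for i
  proof -
    have "pcompose q g = pcompose (\<Sum>j\<le>degree q. monom (coeff q j) j) g"
      by (simp only: poly_as_sum_of_monoms)
    also have "\<dots> = (\<Sum>j\<le>degree q. smult (coeff q j) (g ^ j))"
      by (simp only: pcompose_sum pcompose_monom)
    finally show ?thesis by (simp add: coeff_sum)
  qed
  have "\<exists>t. \<not> int p dvd coeff q t"
  proof (rule ccontr)
    assume "\<not> ?thesis"
    then have "int p dvd coeff (pcompose q g) (p - 1)"
      unfolding expand by (intro dvd_sum) auto
    then have "int p dvd coeff (monom 1 (p - 1)) (p - 1)"
      using q(1)[of "p - 1"] by (metis coeff_diff dvd_diff_commute dvd_diff_right_iff diff_add_cancel dvd_add)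
    then show False using p_gt_1 by simp
  qed
  then obtain t where t: "\<not> int p dvd coeff q t" "\<And>j. j < t \<Longrightarrow> int p dvd coeff q j"
    using exists_least_iff[of "\<lambda>t. \<not> int p dvd coeff q t"] by blast
  have "t \<le> degree q" using t(1) by (intro le_degree) auto
  then have "int p dvd coeff (pcompose q g) (r * t) \<longleftrightarrow> int p dvd coeff q t * coeff (g ^ t) (r * t)"
    unfolding expand
  proof (intro dvd_sum_iff_dvd_term)
    fix j assume "j \<noteq> t"
    then consider "j < t" | "t < j" by linarith
    then show "int p dvd coeff q j * coeff (g ^ j) (r * t)"
    proof cases
      case 2
      then have "r * t < r * j" using r_pos by simp
      then show ?thesis
        using has_order_mod_power[OF prime_int_p r, of j] by (simp add: has_order_mod_def)
    qed (simp add: t)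
  qed auto
  moreover have "\<not> int p dvd coeff q t * coeff (g ^ t) (r * t)"
    using has_order_mod_power[OF prime_int_p r, of t] t prime_int_p
    by (simp add: has_order_mod_def prime_dvd_mult_iff)
  ultimately have "\<not> int p dvd coeff (monom 1 (p - 1)) (r * t)"
    using q(1)[of "r * t"] by (metis coeff_diff dvd_diff_right_iff)
  then have rt: "r * t = p - 1" by (auto split: if_splits)
  have "t * e \<le> p - 1"
    using t(1) q(2)[of t] p_gt_1 by (metis Suc_diff_1 dvd_0_right gr_implies_not0 less_Suc_eq_le linorder_not_le neq0_conv)
  then have "t * e \<le> t * r" using rt by (simp add: mult.commute)
  moreover have "0 < t" using rt p_gt_1 by (cases t) auto
  ultimately have "r = e" using r_le by simp
  define a where "a = coeff g e"
  have a: "\<not> int p dvd a" using g_deg by (simp add: a_def has_degree_mod_def)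
  have g_cong: "[poly g x = a * x ^ e] (mod int p)" for x
  proof -
    have "int p dvd coeff (g - monom a e) i" for i
      using g_deg r \<open>r = e\<close> by (cases i e rule: linorder_cases)
        (auto simp: a_def has_degree_mod_def has_order_mod_def)
    then have "int p dvd poly (g - monom a e) x"
      by (simp only: poly_altdef dvd_sum dvd_mult2)
    then show ?thesis by (simp add: cong_iff_dvd_diff poly_monom)
  qed
  show ?thesis
    unfolding color_poly_def
  proof (intro allI impI)
    fix x y assume "C x = C y"
    then have "[a * x ^ e = a * y ^ e] (mod int p)"
      using g g_cong unfolding color_poly_def by (metis cong_sym cong_trans)
    moreover have "coprime a (int p)"
      using a by (rule coprime_int_p)
    ultimately show "[poly (monom 1 e) x = poly (monom 1 e) y] (mod int p)"
      by (simp add: cong_mult_lcancel poly_monom)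
  qed
qed

text \<open>
  With \<open>X ^ e\<close> in the role of \<open>g\<close>, every polynomial of degree below \<open>p\<close> that is constant on color
  classes is a polynomial in \<open>X ^ e\<close>.  Applied to indicators, this makes the color classes and
  \<open>S\<close> invariant under multiplication by \<open>e\<close>-th roots of unity.
\<close>

theorem color_class_multiplier:
  assumes xy: "C x = C y"
  obtains m where "\<not> int p dvd m" "[m * x = y] (mod int p)"
    "\<And>z. C (m * z) = C z" "\<And>z. m * z mod int p \<in> S \<longleftrightarrow> z mod int p \<in> S"
proof -
  obtain e where e: "color_degree e" "0 < e" "\<And>k. color_degree k \<Longrightarrow> e dvd k"
    using least_positive_color_degree by blast
  have mono: "color_poly (monom 1 e)"
    by (rule color_poly_monom_least_degree[OF e])
  have mono_deg: "has_degree_mod (int p) (monom 1 e) e"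
    using p_gt_1 by (auto simp: has_degree_mod_def)
  have invariant: "[poly f (m * z) = poly f z] (mod int p)"
    if f: "color_poly f" "\<And>i. p \<le> i \<Longrightarrow> coeff f i = 0" and m: "[m ^ e = 1] (mod int p)" for f m z
  proof -
    obtain q where q: "\<And>i. int p dvd coeff (f - pcompose q (monom 1 e)) i"
      using color_poly_expansion[OF e(3) mono mono_deg f(1), of p] f(2) by auto
    have fq: "[poly f u = poly q (u ^ e)] (mod int p)" for u
    proof -
      have "int p dvd poly (f - pcompose q (monom 1 e)) u"
        using q by (simp only: poly_altdef dvd_sum dvd_mult2)
      then show ?thesis by (simp add: cong_iff_dvd_diff poly_monom poly_pcompose)
    qed
    have "[(m * z) ^ e = z ^ e] (mod int p)"
      using cong_mult[OF m cong_refl[of "z ^ e"]] by (simp add: power_mult_distrib)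
    then have "[poly q ((m * z) ^ e) = poly q (z ^ e)] (mod int p)"
      unfolding poly_altdef by (intro cong_sum cong_scalar_left) (rule cong_pow)
    then show ?thesis using fq by (metis cong_sym cong_trans)
  qed
  have sym: "C (m * z) = C z" "m * z mod int p \<in> S \<longleftrightarrow> z mod int p \<in> S"
    if m: "[m ^ e = 1] (mod int p)" for m z
  proof -
    show "C (m * z) = C z"
      using indicator_cong_iff[OF indicator_class_cong[of "C z" "m * z"] indicator_class_cong[of "C z" z]]
        invariant[OF color_poly_indicator_class indicator_poly_low_degree m] by blast
    have S0: "S \<subseteq> {0..<int p}" using S_subset by auto
    show "m * z mod int p \<in> S \<longleftrightarrow> z mod int p \<in> S"
      using indicator_cong_iff[OF indicator_poly_cong[OF S0, of "m * z"] indicator_poly_cong[OF S0, of z]]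
        invariant[OF color_poly_indicator_S indicator_poly_low_degree m] by blast
  qed
  have "\<exists>m. \<not> int p dvd m \<and> [m * x = y] (mod int p) \<and> [m ^ e = 1] (mod int p)"
  proof (cases "int p dvd x")
    case True
    then have "int p dvd y" using zero_class_iff[OF xy] by simp
    then show ?thesis
      using True p_gt_1 by (intro exI[of _ 1]) (auto simp: cong_iff_dvd_diff)
  next
    case False
    then have cop: "coprime x (int p)"
      by (rule coprime_int_p)
    then obtain u where u: "[x * u = 1] (mod int p)"
      using cong_solve_coprime_int by blast
    have mx: "[y * u * x = y] (mod int p)"
      using cong_scalar_left[OF u, of y] by (simp add: mult_ac)
    have "\<not> int p dvd y" using False zero_class_iff[OF xy] by simp
    then have "\<not> int p dvd y * u"
      using mx by (metis cong_dvd_iff dvd_mult2)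
    moreover have "[(y * u) ^ e = 1] (mod int p)"
    proof -
      have "[x ^ e = y ^ e] (mod int p)"
        using mono xy by (simp add: color_poly_def poly_monom)
      then have "[(y * u) ^ e * x ^ e = 1 * x ^ e] (mod int p)"
        using cong_pow[OF mx, of e] by (metis cong_sym cong_trans mult_1 power_mult_distrib)
      moreover have "coprime (x ^ e) (int p)" using cop by simp
      ultimately show ?thesis using cong_mult_rcancel by blast
    qed
    ultimately show ?thesis using mx by blast
  qed
  then show ?thesis using that sym by blast
qed

end

section \<open>Color-preserving isomorphisms and runs of the algorithm\<close>

definition graph_isomorphism ::
    "'a pair_pre_digraph \<Rightarrow> 'b pair_pre_digraph \<Rightarrow> ('a \<Rightarrow> 'b) \<Rightarrow> bool" where
  "graph_isomorphism G H \<phi> \<longleftrightarrow>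
    bij_betw \<phi> (pverts G) (pverts H) \<and>
    (\<forall>u\<in>pverts G. \<forall>v\<in>pverts G. (u, v) \<in> parcs G \<longleftrightarrow> (\<phi> u, \<phi> v) \<in> parcs H)"

definition color_isomorphism ::
    "'a pair_pre_digraph \<Rightarrow> 'b pair_pre_digraph \<Rightarrow> ('a + 'b) coloring \<Rightarrow> ('a \<Rightarrow> 'b) \<Rightarrow> bool" where
  "color_isomorphism G H c \<phi> \<longleftrightarrow>
    graph_isomorphism G H \<phi> \<and> (\<forall>v\<in>pverts G. c (Inl v) = c (Inr (\<phi> v)))"

lemma graph_isomorphic_iff:
  assumes "pair_digraph G" "pair_digraph H"
  shows "graph_isomorphic G H \<longleftrightarrow> (\<exists>\<phi>. graph_isomorphism G H \<phi>)"
proof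
  interpret G: pair_digraph G by fact
  interpret H: pair_digraph H by fact
  show "\<exists>\<phi>. graph_isomorphism G H \<phi>" if iso: "graph_isomorphic G H"
  proof -
    obtain f where f: "pre_digraph.digraph_isomorphism (with_proj G) f"
      and H: "with_proj H = app_iso f (with_proj G)"
      using iso unfolding graph_isomorphic_def digraph_iso_def by blast
    define \<phi> where "\<phi> = iso_verts f"
    have verts: "pverts H = \<phi> ` pverts G" and arcs: "parcs H = iso_arcs f ` parcs G"
      and tail: "iso_tail f = fst" and head: "iso_head f = snd"
      using H by (auto simp: with_proj_def app_iso_def \<phi>_def)
    have inj: "inj_on \<phi> (pverts G)"
      using f by (simp add: pre_digraph.digraph_isomorphism_def \<phi>_def)
    have arc: "iso_arcs f a = (\<phi> (fst a), \<phi> (snd a))" if "a \<in> parcs G" for a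
      using f that unfolding pre_digraph.digraph_isomorphism_def \<phi>_def tail head
      by (auto intro: prod_eqI)
    have "(u, v) \<in> parcs G \<longleftrightarrow> (\<phi> u, \<phi> v) \<in> parcs H" if "u \<in> pverts G" "v \<in> pverts G" for u v
    proof
      assume "(\<phi> u, \<phi> v) \<in> parcs H"
      then obtain a where a: "a \<in> parcs G" "(\<phi> u, \<phi> v) = (\<phi> (fst a), \<phi> (snd a))"
        using arcs arc by auto
      then have "u = fst a" "v = snd a"
        using inj that G.arc_fst_in_verts G.arc_snd_in_verts by (auto dest: inj_onD)
      then show "(u, v) \<in> parcs G" using a by simp
    qed (use arc arcs in force)
    then show ?thesis
      using inj verts by (auto simp: graph_isomorphism_def bij_betw_def)
  qed
  show "graph_isomorphic G H" if iso: "\<exists>\<phi>. graph_isomorphism G H \<phi>"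
  proof -
    obtain \<phi> where \<phi>: "graph_isomorphism G H \<phi>" using iso by blast
    have inj: "inj_on \<phi> (pverts G)" and verts: "pverts H = \<phi> ` pverts G"
      using \<phi> by (auto simp: graph_isomorphism_def bij_betw_def)
    have arcs: "parcs H = map_prod \<phi> \<phi> ` parcs G"
    proof (intro equalityI subsetI)
      fix a assume a: "a \<in> parcs H"
      have "fst a \<in> \<phi> ` pverts G" "snd a \<in> \<phi> ` pverts G"
        using H.arc_fst_in_verts[OF a] H.arc_snd_in_verts[OF a] verts by auto
      then obtain u v where uv: "fst a = \<phi> u" "snd a = \<phi> v" "u \<in> pverts G" "v \<in> pverts G"
        by blast
      then have "a = map_prod \<phi> \<phi> (u, v)"
        by (simp add: prod_eq_iff)
      moreover have "(u, v) \<in> parcs G"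
        using \<phi> a uv calculation by (simp add: graph_isomorphism_def)
      ultimately show "a \<in> map_prod \<phi> \<phi> ` parcs G"
        by blast
    next
      fix a assume "a \<in> map_prod \<phi> \<phi> ` parcs G"
      then obtain u v where uv: "a = (\<phi> u, \<phi> v)" "(u, v) \<in> parcs G"
        by auto
      then show "a \<in> parcs H"
        using \<phi> G.in_arcsD1[OF uv(2)] G.in_arcsD2[OF uv(2)] unfolding graph_isomorphism_def by blast
    qed
    have "inj_on (map_prod \<phi> \<phi>) (pverts G \<times> pverts G)"
      using inj by (intro map_prod_inj_on)
    then have "inj_on (map_prod \<phi> \<phi>) (parcs G)"
      by (rule inj_on_subset) (use G.in_arcsD1 G.in_arcsD2 in auto)
    then have "pre_digraph.digraph_isomorphism (with_proj G)
        \<lparr>iso_verts = \<phi>, iso_arcs = map_prod \<phi> \<phi>, iso_head = snd, iso_tail = fst\<rparr>"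
      using inj G.wf_digraph_axioms by (simp add: pre_digraph.digraph_isomorphism_def)
    moreover have "with_proj H = app_iso
        \<lparr>iso_verts = \<phi>, iso_arcs = map_prod \<phi> \<phi>, iso_head = snd, iso_tail = fst\<rparr> (with_proj G)"
      by (simp add: app_iso_def with_proj_def verts arcs)
    ultimately show ?thesis
      unfolding graph_isomorphic_def digraph_iso_def by blast
  qed
qed

lemma pverts_disjoint_union [simp]: "pverts (disjoint_union G H) = pverts G <+> pverts H"
  by (simp add: disjoint_union_def)

lemma Inl_in_Plus_iff: "Inl v \<in> A <+> B \<longleftrightarrow> v \<in> A"
  and Inr_in_Plus_iff: "Inr w \<in> A <+> B \<longleftrightarrow> w \<in> B"
  by auto

lemma in_mset_setD: "x \<in># mset_set A \<Longrightarrow> x \<in> A"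
  by (cases "finite A") auto

lemma in_neighbor_colors_Inl:
  "in_neighbor_colors (disjoint_union G H) c (Inl v) = in_neighbor_colors G (c \<circ> Inl) v"
proof -
  have "{h \<in> pverts (disjoint_union G H). (h, Inl v) \<in> parcs (disjoint_union G H)}
      = Inl ` {h \<in> pverts G. (h, v) \<in> parcs G}"
    by (auto simp: disjoint_union_def)
  then show ?thesis
    by (simp add: in_neighbor_colors_def multiset.map_comp flip: image_mset_mset_set)
qed

lemma in_neighbor_colors_Inr:
  "in_neighbor_colors (disjoint_union G H) c (Inr v) = in_neighbor_colors H (c \<circ> Inr) v"
proof -
  have "{h \<in> pverts (disjoint_union G H). (h, Inr v) \<in> parcs (disjoint_union G H)}
      = Inr ` {h \<in> pverts H. (h, v) \<in> parcs H}"
    by (auto simp: disjoint_union_def)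
  then show ?thesis
    by (simp add: in_neighbor_colors_def multiset.map_comp flip: image_mset_mset_set)
qed

lemma in_neighbor_colors_color_isomorphism:
  assumes \<phi>: "color_isomorphism G H c \<phi>" and v: "v \<in> pverts G"
  shows "in_neighbor_colors H (c \<circ> Inr) (\<phi> v) = in_neighbor_colors G (c \<circ> Inl) v"
proof -
  let ?N = "{h \<in> pverts G. (h, v) \<in> parcs G}"
  have N: "{h \<in> pverts H. (h, \<phi> v) \<in> parcs H} = \<phi> ` ?N"
  proof (intro equalityI subsetI)
    fix y assume y: "y \<in> {h \<in> pverts H. (h, \<phi> v) \<in> parcs H}"
    have "\<phi> ` pverts G = pverts H"
      using \<phi> by (simp add: color_isomorphism_def graph_isomorphism_def bij_betw_def)
    then obtain h where h: "h \<in> pverts G" "y = \<phi> h"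
      using y by blast
    then show "y \<in> \<phi> ` ?N"
      using \<phi> v y by (simp add: color_isomorphism_def graph_isomorphism_def)
  qed (use \<phi> v in \<open>auto simp: color_isomorphism_def graph_isomorphism_def bij_betw_def\<close>)
  have "inj_on \<phi> ?N"
    using \<phi> by (auto simp: color_isomorphism_def graph_isomorphism_def bij_betw_def intro: inj_on_subset)
  then have "mset_set (\<phi> ` ?N) = image_mset \<phi> (mset_set ?N)"
    by (simp add: image_mset_mset_set)
  then have "in_neighbor_colors H (c \<circ> Inr) (\<phi> v)
      = image_mset (\<lambda>h. c (Inr (\<phi> h))) (mset_set ?N)"
    by (simp add: in_neighbor_colors_def N multiset.map_comp comp_def)
  also have "\<dots> = image_mset (\<lambda>h. c (Inl h)) (mset_set ?N)"
  proof (rule image_mset_cong)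
    fix h assume "h \<in># mset_set ?N"
    then have "h \<in> ?N" by (rule in_mset_setD)
    then show "c (Inr (\<phi> h)) = c (Inl h)"
      using \<phi> by (simp add: color_isomorphism_def)
  qed
  finally show ?thesis by (simp add: in_neighbor_colors_def comp_def)
qed

lemma color_isomorphism_refinement_step:
  assumes "color_isomorphism G H c \<phi>" "refinement_step (disjoint_union G H) c c'"
  shows "color_isomorphism G H c' \<phi>"
proof -
  have "c' (Inl v) = c' (Inr (\<phi> v))" if "v \<in> pverts G" for v
  proof -
    have "\<phi> v \<in> pverts H"
      using assms(1) that by (auto simp: color_isomorphism_def graph_isomorphism_def bij_betw_def)
    then show ?thesis
      using assms that in_neighbor_colors_color_isomorphism[OF assms(1) that]
      by (simp add: refinement_step_def color_isomorphism_def in_neighbor_colors_Inl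
          in_neighbor_colors_Inr Inl_in_Plus_iff Inr_in_Plus_iff)
  qed
  then show ?thesis
    using assms(1) by (simp add: color_isomorphism_def)
qed

lemma color_isomorphism_color_multisets_agree:
  assumes "color_isomorphism G H c \<phi>"
  shows "color_multisets_agree G H c"
proof -
  have bij: "bij_betw \<phi> (pverts G) (pverts H)"
    using assms by (simp add: color_isomorphism_def graph_isomorphism_def)
  then have "mset_set (pverts H) = image_mset \<phi> (mset_set (pverts G))"
    by (simp add: bij_betw_def image_mset_mset_set)
  then have "image_mset (c \<circ> Inr) (mset_set (pverts H))
      = image_mset (\<lambda>v. c (Inr (\<phi> v))) (mset_set (pverts G))"
    by (simp add: multiset.map_comp comp_def)
  also have "\<dots> = image_mset (c \<circ> Inl) (mset_set (pverts G))"
  proof (rule image_mset_cong)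
    fix v assume "v \<in># mset_set (pverts G)"
    then have "v \<in> pverts G" by (rule in_mset_setD)
    then show "c (Inr (\<phi> v)) = (c \<circ> Inl) v"
      using assms by (simp add: color_isomorphism_def)
  qed
  finally show ?thesis by (simp add: color_multisets_agree_def)
qed

lemma refinement_step_exists:
  assumes "finite (pverts X)"
  shows "\<exists>c'. refinement_step X c c'"
proof -
  let ?K = "\<lambda>v. (c v, in_neighbor_colors X c v)"
  obtain f :: "nat \<times> nat multiset \<Rightarrow> nat" where "inj_on f (?K ` pverts X)"
    using finite_imp_inj_to_nat_seg[of "?K ` pverts X"] assms by auto
  then have "refinement_step X c (f \<circ> ?K)"
    unfolding refinement_step_def by (auto dest: inj_onD)
  then show ?thesis by blast
qed

lemma stable_iff_equitable:
  assumes "finite (pverts X)"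
  shows "stable X c \<longleftrightarrow> (\<forall>v\<in>pverts X. \<forall>v'\<in>pverts X.
    c v = c v' \<longrightarrow> in_neighbor_colors X c v = in_neighbor_colors X c v')"
proof
  obtain c' where "refinement_step X c c'"
    using refinement_step_exists[OF assms] by blast
  then show "\<forall>v\<in>pverts X. \<forall>v'\<in>pverts X.
      c v = c v' \<longrightarrow> in_neighbor_colors X c v = in_neighbor_colors X c v'" if "stable X c"
    using that unfolding stable_def same_partition_def refinement_step_def by blast
qed (unfold stable_def same_partition_def refinement_step_def, blast)

lemma stable_disjoint_union_Inl:
  assumes "finite (pverts G)" "finite (pverts H)" "stable (disjoint_union G H) c"
  shows "stable G (c \<circ> Inl)"
proof -
  have "finite (pverts (disjoint_union G H))" using assms by simp
  then have *: "\<forall>v\<in>pverts G <+> pverts H. \<forall>v'\<in>pverts G <+> pverts H. c v = c v' \<longrightarrow>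
      in_neighbor_colors (disjoint_union G H) c v = in_neighbor_colors (disjoint_union G H) c v'"
    using assms(3) stable_iff_equitable by (metis pverts_disjoint_union)
  show ?thesis
    unfolding stable_iff_equitable[OF assms(1)]
  proof (intro ballI impI)
    fix v v' assume "v \<in> pverts G" "v' \<in> pverts G" "(c \<circ> Inl) v = (c \<circ> Inl) v'"
    then show "in_neighbor_colors G (c \<circ> Inl) v = in_neighbor_colors G (c \<circ> Inl) v'"
      using *[rule_format, of "Inl v" "Inl v'"]
      by (simp add: in_neighbor_colors_Inl Inl_in_Plus_iff)
  qed
qed

text \<open>
  The number of classes is bounded by the number of vertices, so this makes every run finite.
\<close>

lemma card_classes_less:
  assumes fin: "finite V" and refines: "\<And>v v'. v \<in> V \<Longrightarrow> v' \<in> V \<Longrightarrow> c' v = c' v' \<Longrightarrow> c v = c v'"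
    and split: "v \<in> V" "v' \<in> V" "c v = c v'" "c' v \<noteq> c' v'"
  shows "card (c ` V) < card (c' ` V)"
proof -
  define h where "h = c \<circ> inv_into V c'"
  have h: "h (c' u) = c u" if "u \<in> V" for u
    unfolding h_def comp_def using that by (intro refines) (auto simp: inv_into_into f_inv_into_f)
  then have img: "c ` V = h ` c' ` V"
    by (simp add: image_image)
  have "\<not> inj_on h (c' ` V)"
    using split h by (metis imageI inj_onD)
  then have "card (h ` c' ` V) \<noteq> card (c' ` V)"
    using fin eq_card_imp_inj_on by blast
  then show ?thesis
    using card_image_le[of "c' ` V" h] fin unfolding img by simp
qed

context
  fixes G :: "'a pair_pre_digraph" and H :: "'b pair_pre_digraph"
  assumes G: "pair_digraph G" and H: "pair_digraph H"
begin

interpretation G: pair_digraph G by (rule G)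
interpretation H: pair_digraph H by (rule H)

lemma finite_disjoint_union: "finite (pverts (disjoint_union G H))"
  using G.pair_finite_verts H.pair_finite_verts by simp

lemma tinhofer_step_card_classes:
  assumes "tinhofer_step G H (Running c) (Running c')"
  shows "card (c ` pverts (disjoint_union G H)) < card (c' ` pverts (disjoint_union G H))"
  using assms
proof cases
  case refine
  then obtain c'' where "refinement_step (disjoint_union G H) c c''"
      "\<not> same_partition (disjoint_union G H) c c''"
    unfolding stable_def by blast
  then obtain v v' where "v \<in> pverts (disjoint_union G H)" "v' \<in> pverts (disjoint_union G H)"
      "c v = c v'" "c' v \<noteq> c' v'"
    using refine(2) unfolding refinement_step_def same_partition_def by blast
  then show ?thesis
    using refine(2) unfolding refinement_step_def
    by (intro card_classes_less[of _ c' c v v', OF finite_disjoint_union]) blast+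
next
  case (individualize v w k)
  let ?V = "pverts (disjoint_union G H)"
  have "\<exists>x\<in>pverts G. x \<noteq> v \<and> c (Inl x) = c (Inl v)"
  proof (rule ccontr)
    assume "\<not> ?thesis"
    then have "{x \<in> pverts G. c (Inl x) = c (Inl v)} \<subseteq> {v}" by blast
    then have "card {x \<in> pverts G. c (Inl x) = c (Inl v)} \<le> card {v}" by (intro card_mono) auto
    then show False using individualize by simp
  qed
  then obtain x where x: "x \<in> pverts G" "x \<noteq> v" "c (Inl x) = c (Inl v)" by blast
  \<comment> \<open>The old color of \<open>v\<close> survives at \<open>x\<close>, so the fresh color \<open>k\<close> adds a class.\<close>
  have "insert k (c ` ?V) \<subseteq> c' ` ?V"
  proof (intro subsetI)
    fix l assume "l \<in> insert k (c ` ?V)"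
    then consider "l = k" | "l = c (Inl v)" | z where "l = c z" "z \<in> ?V" "z \<noteq> Inl v" "z \<noteq> Inr w"
      using individualize(7) by (cases "l = k") auto
    then show "l \<in> c' ` ?V"
    proof cases
      case 1
      then have "l = c' (Inl v)" "Inl v \<in> ?V" using individualize by auto
      then show ?thesis by blast
    next
      case 2
      then have "l = c' (Inl x)" "Inl x \<in> ?V" using individualize x by auto
      then show ?thesis by blast
    next
      case 3
      then have "l = c' z" using individualize by auto
      then show ?thesis using 3 by blast
    qed
  qed
  then have "card (insert k (c ` ?V)) \<le> card (c' ` ?V)"
    using finite_disjoint_union by (intro card_mono) auto
  then show ?thesis
    using individualize finite_disjoint_union by simp
qed

lemma tinhofer_terminates: "Wellfounded.accp (tinhofer_step G H)\<inverse>\<inverse> (Running c)"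
proof (induction "card (pverts (disjoint_union G H)) - card (c ` pverts (disjoint_union G H))"
    arbitrary: c rule: less_induct)
  case less
  show ?case
  proof (rule accp.accI)
    fix s assume "(tinhofer_step G H)\<inverse>\<inverse> s (Running c)"
    then have step: "tinhofer_step G H (Running c) s" by simp
    show "Wellfounded.accp (tinhofer_step G H)\<inverse>\<inverse> s"
    proof (cases s)
      case (Running c')
      have "card (c' ` pverts (disjoint_union G H)) \<le> card (pverts (disjoint_union G H))"
        by (rule card_image_le[OF finite_disjoint_union])
      then show ?thesis
        using less tinhofer_step_card_classes step unfolding Running
        by (meson diff_less_mono2 order_less_le_trans)
    next
      case (Answer b)
      show ?thesis
        unfolding Answer by (rule accp.accI) (auto elim: tinhofer_step.cases)
    qed
  qed
qed

lemma tinhofer_progress: "\<exists>s. tinhofer_step G H (Running c) s"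
proof (cases "stable (disjoint_union G H) c")
  case False
  then show ?thesis
    using refinement_step_exists[OF finite_disjoint_union] tinhofer_step.refine by blast
next
  case stable: True
  show ?thesis
  proof (cases "color_multisets_agree G H c \<and> \<not> inj_on (c \<circ> Inl) (pverts G)")
    case False
    then show ?thesis
      using stable tinhofer_step.reject tinhofer_step.accept by blast
  next
    case True
    then obtain v v' where v: "v \<in> pverts G" "v' \<in> pverts G" "v \<noteq> v'" "c (Inl v) = c (Inl v')"
      by (auto simp: inj_on_def)
    have "count (image_mset (c \<circ> Inl) (mset_set (pverts G))) (c (Inl v))
        = card {x \<in> pverts G. c (Inl x) = c (Inl v)}"
      using G.pair_finite_verts by (simp add: count_image_mset' sum.If_cases Int_def conj_commute eq_commute)
    moreover have "count (image_mset (c \<circ> Inr) (mset_set (pverts H))) (c (Inl v))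
        = card {y \<in> pverts H. c (Inr y) = c (Inl v)}"
      using H.pair_finite_verts by (simp add: count_image_mset' sum.If_cases Int_def conj_commute eq_commute)
    ultimately have card_eq: "card {x \<in> pverts G. c (Inl x) = c (Inl v)}
        = card {y \<in> pverts H. c (Inr y) = c (Inl v)}"
      using True by (simp add: color_multisets_agree_def)
    have "card {v, v'} \<le> card {x \<in> pverts G. c (Inl x) = c (Inl v)}"
      using v G.pair_finite_verts by (intro card_mono) auto
    then have card_G: "2 \<le> card {x \<in> pverts G. c (Inl x) = c (Inl v)}"
      using v by simp
    then have "{y \<in> pverts H. c (Inr y) = c (Inl v)} \<noteq> {}"
      unfolding card_eq by (metis card.empty not_numeral_le_zero)
    then obtain w where w: "w \<in> pverts H" "c (Inl v) = c (Inr w)" by auto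
    have "card {y \<in> pverts H. c (Inr y) = c (Inr w)} \<ge> 2"
      using card_G card_eq w by simp
    moreover obtain k where "k \<notin> c ` pverts (disjoint_union G H)"
      using ex_new_if_finite[of "c ` pverts (disjoint_union G H)"] finite_disjoint_union by auto
    ultimately show ?thesis
      using tinhofer_step.individualize[OF stable _ _ v(1) w card_G] True by blast
  qed
qed

text \<open>
  Matching vertices of equal color is a bijection.  It preserves arcs because, in a discrete
  coloring, the multiset of in-neighbor colors determines the set of in-neighbors.
\<close>

lemma discrete_stable_coloring_isomorphism:
  assumes stable: "stable (disjoint_union G H) c" and agree: "color_multisets_agree G H c"
    and inj: "inj_on (c \<circ> Inl) (pverts G)"
  shows "\<exists>\<phi>. graph_isomorphism G H \<phi>"
proof -
  have sizes: "card (pverts G) = card (pverts H)"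
    using arg_cong[OF agree[unfolded color_multisets_agree_def], of size] by simp
  have img: "(c \<circ> Inl) ` pverts G = (c \<circ> Inr) ` pverts H"
    using arg_cong[OF agree[unfolded color_multisets_agree_def], of set_mset]
      G.pair_finite_verts H.pair_finite_verts by simp
  have inj': "inj_on (c \<circ> Inr) (pverts H)"
    using H.pair_finite_verts card_image[OF inj] sizes img by (intro eq_card_imp_inj_on) auto
  define \<phi> where "\<phi> = inv_into (pverts H) (c \<circ> Inr) \<circ> (c \<circ> Inl)"
  have bij: "bij_betw \<phi> (pverts G) (pverts H)"
    unfolding \<phi>_def
  proof (rule bij_betw_trans)
    show "bij_betw (c \<circ> Inl) (pverts G) ((c \<circ> Inl) ` pverts G)"
      using inj by (rule inj_on_imp_bij_betw)
    show "bij_betw (inv_into (pverts H) (c \<circ> Inr)) ((c \<circ> Inl) ` pverts G) (pverts H)"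
      using bij_betw_inv_into[OF inj_on_imp_bij_betw[OF inj']] unfolding img .
  qed
  have color: "c (Inr (\<phi> v)) = c (Inl v)" if "v \<in> pverts G" for v
    using f_inv_into_f[of "(c \<circ> Inl) v" "c \<circ> Inr" "pverts H"] that img by (auto simp: \<phi>_def)
  have \<phi>_in: "\<phi> v \<in> pverts H" if "v \<in> pverts G" for v
    using bij that by (auto simp: bij_betw_def)
  have "(u, v) \<in> parcs G \<longleftrightarrow> (\<phi> u, \<phi> v) \<in> parcs H" if u: "u \<in> pverts G" and v: "v \<in> pverts G" for u v
  proof -
    have "in_neighbor_colors (disjoint_union G H) c (Inl v)
        = in_neighbor_colors (disjoint_union G H) c (Inr (\<phi> v))"
      using stable color[OF v] v \<phi>_in[OF v]
      unfolding stable_iff_equitable[OF finite_disjoint_union]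
      by (simp add: Inl_in_Plus_iff Inr_in_Plus_iff)
    then have "in_neighbor_colors G (c \<circ> Inl) v = in_neighbor_colors H (c \<circ> Inr) (\<phi> v)"
      by (simp add: in_neighbor_colors_Inl in_neighbor_colors_Inr)
    from arg_cong[OF this, of set_mset]
    have "(c \<circ> Inl) ` {h \<in> pverts G. (h, v) \<in> parcs G}
        = (c \<circ> Inr) ` {h \<in> pverts H. (h, \<phi> v) \<in> parcs H}"
      using G.pair_finite_verts H.pair_finite_verts by (simp add: in_neighbor_colors_def)
    then have "c (Inl u) \<in> (c \<circ> Inl) ` {h \<in> pverts G. (h, v) \<in> parcs G}
        \<longleftrightarrow> c (Inr (\<phi> u)) \<in> (c \<circ> Inr) ` {h \<in> pverts H. (h, \<phi> v) \<in> parcs H}"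
      unfolding color[OF u] by (rule arg_cong)
    moreover have "c (Inl u) \<in> (c \<circ> Inl) ` {h \<in> pverts G. (h, v) \<in> parcs G} \<longleftrightarrow> (u, v) \<in> parcs G"
      using inj u by (auto simp: inj_on_def)
    moreover have "c (Inr (\<phi> u)) \<in> (c \<circ> Inr) ` {h \<in> pverts H. (h, \<phi> v) \<in> parcs H}
        \<longleftrightarrow> (\<phi> u, \<phi> v) \<in> parcs H"
      using inj' \<phi>_in[OF u] by (auto simp: inj_on_def)
    ultimately show ?thesis by simp
  qed
  then show ?thesis
    using bij by (auto simp: graph_isomorphism_def)
qed

end

lemma graph_isomorphism_comp:
  assumes "graph_isomorphism G G \<sigma>" "graph_isomorphism G H \<phi>"
  shows "graph_isomorphism G H (\<phi> \<circ> \<sigma>)"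
proof -
  have "bij_betw (\<phi> \<circ> \<sigma>) (pverts G) (pverts H)"
    using assms bij_betw_trans unfolding graph_isomorphism_def by blast
  moreover have "\<sigma> x \<in> pverts G" if "x \<in> pverts G" for x
    using assms(1) that by (auto simp: graph_isomorphism_def bij_betw_def)
  moreover have "(u, v) \<in> parcs G \<longleftrightarrow> (\<sigma> u, \<sigma> v) \<in> parcs G"
    if "u \<in> pverts G" "v \<in> pverts G" for u v
    using assms(1) that unfolding graph_isomorphism_def by blast
  moreover have "(u, v) \<in> parcs G \<longleftrightarrow> (\<phi> u, \<phi> v) \<in> parcs H"
    if "u \<in> pverts G" "v \<in> pverts G" for u v
    using assms(2) that unfolding graph_isomorphism_def by blast
  ultimately show ?thesis
    by (auto simp: graph_isomorphism_def)
qed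

text \<open>
  A sufficient condition that speaks about the first graph alone.  \<open>J\<close> describes the colorings
  that can arise on it; for these, color classes of stable colorings have to be orbits of
  color-preserving automorphisms.  The invariant of a run against an isomorphic graph is \<open>J\<close>
  together with the existence of a color-preserving isomorphism.
\<close>

theorem tinhofer_property_criterion:
  fixes G :: "'a pair_pre_digraph" and J :: "'a coloring \<Rightarrow> bool"
  assumes G: "pair_digraph G"
    and start: "J (\<lambda>_. 0)"
    and refine: "\<And>d d'. J d \<Longrightarrow> refinement_step G d d' \<Longrightarrow> J d'"
    and individualize: "\<And>d v k. J d \<Longrightarrow> v \<in> pverts G \<Longrightarrow> k \<notin> d ` pverts G \<Longrightarrow> J (d(v := k))"
    and orbits: "\<And>d u v. J d \<Longrightarrow> stable G d \<Longrightarrow> u \<in> pverts G \<Longrightarrow> v \<in> pverts G \<Longrightarrow> d u = d v \<Longrightarrow>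
      \<exists>\<sigma>. graph_isomorphism G G \<sigma> \<and> (\<forall>x\<in>pverts G. d (\<sigma> x) = d x) \<and> \<sigma> u = v"
  shows "tinhofer_property TYPE('b) G"
  unfolding tinhofer_property_def
proof (intro conjI allI impI G)
  fix H :: "'b pair_pre_digraph"
  assume H: "pair_digraph H"
  define Inv where "Inv c \<longleftrightarrow> J (c \<circ> Inl) \<and> (\<exists>\<phi>. color_isomorphism G H c \<phi>)" for c
  have step: "Inv c'" if c: "Inv c" and "tinhofer_step G H (Running c) (Running c')" for c c'
    using that(2)
  proof cases
    case refine': refine
    have "refinement_step G (c \<circ> Inl) (c' \<circ> Inl)"
      unfolding refinement_step_def
    proof (intro ballI)
      fix v v' assume "v \<in> pverts G" "v' \<in> pverts G"
      then show "(c' \<circ> Inl) v = (c' \<circ> Inl) v' \<longleftrightarrow> (c \<circ> Inl) v = (c \<circ> Inl) v' \<and>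
          in_neighbor_colors G (c \<circ> Inl) v = in_neighbor_colors G (c \<circ> Inl) v'"
        using refine'(2)[unfolded refinement_step_def, rule_format, of "Inl v" "Inl v'"]
        by (simp add: in_neighbor_colors_Inl Inl_in_Plus_iff)
    qed
    then show ?thesis
      using c refine color_isomorphism_refinement_step[OF _ refine'(2)] unfolding Inv_def by blast
  next
    case (individualize v w k)
    obtain \<phi> where \<phi>: "color_isomorphism G H c \<phi>" using c by (auto simp: Inv_def)
    have "bij_betw \<phi> (pverts G) (pverts H)"
      using \<phi> by (simp add: color_isomorphism_def graph_isomorphism_def)
    then obtain u where u: "u \<in> pverts G" "w = \<phi> u"
      using individualize by (auto simp: bij_betw_def)
    have "stable G (c \<circ> Inl)"
      using stable_disjoint_union_Inl individualize G H
      by (metis pair_digraph.axioms(1) pair_fin_digraph.pair_finite_verts)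
    moreover have "(c \<circ> Inl) v = (c \<circ> Inl) u"
      using individualize u \<phi> by (simp add: color_isomorphism_def)
    ultimately obtain \<sigma> where \<sigma>: "graph_isomorphism G G \<sigma>" "\<forall>x\<in>pverts G. c (Inl (\<sigma> x)) = c (Inl x)"
        "\<sigma> v = u"
      using orbits[of "c \<circ> Inl" v u] c u individualize by (auto simp: Inv_def)
    have \<sigma>_in: "\<sigma> x \<in> pverts G" if "x \<in> pverts G" for x
      using \<sigma> that by (auto simp: graph_isomorphism_def bij_betw_def)
    have comp: "graph_isomorphism G H (\<phi> \<circ> \<sigma>)"
      using graph_isomorphism_comp \<sigma> \<phi> unfolding color_isomorphism_def by blast
    have "color_isomorphism G H c' (\<phi> \<circ> \<sigma>)"
      unfolding color_isomorphism_def
    proof (intro conjI ballI comp)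
      fix x assume x: "x \<in> pverts G"
      have inj: "inj_on (\<phi> \<circ> \<sigma>) (pverts G)"
        using comp by (simp add: graph_isomorphism_def bij_betw_def)
      show "c' (Inl x) = c' (Inr ((\<phi> \<circ> \<sigma>) x))"
      proof (cases "x = v")
        case True
        then show ?thesis using individualize \<sigma> u by simp
      next
        case False
        then have "(\<phi> \<circ> \<sigma>) x \<noteq> w"
          using inj_onD[OF inj _ x \<open>v \<in> pverts G\<close>] \<sigma>(3) u by auto
        moreover have "c (Inr ((\<phi> \<circ> \<sigma>) x)) = c (Inl x)"
          using \<phi> \<sigma>(2) \<sigma>_in[OF x] x unfolding color_isomorphism_def by (metis comp_apply)
        ultimately show ?thesis using False individualize by simp
      qed
    qed
    moreover have "c' \<circ> Inl = (c \<circ> Inl)(v := k)"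
      using individualize by auto
    moreover have "k \<notin> (c \<circ> Inl) ` pverts G"
      using individualize by auto
    ultimately show ?thesis
      using assms(4)[of "c \<circ> Inl" v k] c individualize unfolding Inv_def by auto
  qed
  have Inv_reachable: "Inv c"
    if "graph_isomorphism G H \<phi>" "(tinhofer_step G H)\<^sup>*\<^sup>* (Running (\<lambda>_. 0)) (Running c)" for \<phi> c
  proof -
    have "case s of Running c \<Rightarrow> Inv c | Answer _ \<Rightarrow> True"
      if "(tinhofer_step G H)\<^sup>*\<^sup>* (Running (\<lambda>_. 0)) s" for s
      using that
    proof (induction rule: rtranclp_induct)
      case base
      have "color_isomorphism G H (\<lambda>_. 0) \<phi>"
        using \<open>graph_isomorphism G H \<phi>\<close> by (simp add: color_isomorphism_def)
      then show ?case using start by (auto simp: Inv_def comp_def)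
    next
      case (step s s')
      then show ?case
        using \<open>\<And>c c'. Inv c \<Longrightarrow> tinhofer_step G H (Running c) (Running c') \<Longrightarrow> Inv c'\<close>
        by (cases s; cases s') (auto elim: tinhofer_step.cases)
    qed
    from this[OF that(2)] show ?thesis by simp
  qed
  show "tinhofer_correct G H"
    unfolding tinhofer_correct_def
  proof (intro conjI allI impI tinhofer_terminates[OF G H])
    fix s
    assume s: "(tinhofer_step G H)\<^sup>*\<^sup>* (Running (\<lambda>_. 0)) s \<and> (\<nexists>s'. tinhofer_step G H s s')"
    then obtain b where b: "s = Answer b"
      using tinhofer_progress[OF G H] by (cases s) blast+
    then obtain c where c: "(tinhofer_step G H)\<^sup>*\<^sup>* (Running (\<lambda>_. 0)) (Running c)"
        "tinhofer_step G H (Running c) (Answer b)"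
    proof -
      assume *: "\<And>c. (tinhofer_step G H)\<^sup>*\<^sup>* (Running (\<lambda>_. 0)) (Running c) \<Longrightarrow>
        tinhofer_step G H (Running c) (Answer b) \<Longrightarrow> thesis"
      have "(tinhofer_step G H)\<^sup>*\<^sup>* (Running (\<lambda>_. 0)) (Answer b)" using s b by simp
      then show thesis
      proof cases
        case (rtrancl_into_rtrancl s')
        then show ?thesis using * by (cases s') (auto elim: tinhofer_step.cases)
      qed
    qed
    from c(2) have "b \<longleftrightarrow> (\<exists>\<phi>. graph_isomorphism G H \<phi>)"
    proof cases
      case reject
      then show ?thesis
        using Inv_reachable[OF _ c(1)] color_isomorphism_color_multisets_agree
        unfolding Inv_def by blast
    next
      case accept
      then show ?thesis
        using discrete_stable_coloring_isomorphism[OF G H] by blast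
    qed
    then show "s = Answer (graph_isomorphic G H)"
      using b graph_isomorphic_iff[OF G H] by simp
  qed
qed

section \<open>Circulant graphs of prime order\<close>

lemma affine_bij_betw_mod:
  fixes p :: nat and m t :: int
  assumes p: "Factorial_Ring.prime p" and m: "\<not> int p dvd m"
  shows "bij_betw (\<lambda>x. (m * x + t) mod int p) {0..<int p} {0..<int p}"
proof -
  have pos: "0 < int p" using p prime_gt_0_nat by simp
  have cop: "coprime m (int p)"
    using m p prime_imp_coprime[of "int p" m] by (simp add: coprime_commute)
  have "inj_on (\<lambda>x. (m * x + t) mod int p) {0..<int p}"
  proof (rule inj_onI)
    fix x y assume xy: "x \<in> {0..<int p}" "y \<in> {0..<int p}" "(m * x + t) mod int p = (m * y + t) mod int p"
    then have "[m * x + t = m * y + t] (mod int p)" by (simp add: cong_def)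
    then have "[m * x = m * y] (mod int p)" by (simp only: cong_add_rcancel)
    then have "[x = y] (mod int p)" using cop by (simp add: cong_mult_lcancel)
    then show "x = y" using xy by (simp add: cong_def)
  qed
  moreover have "(\<lambda>x. (m * x + t) mod int p) ` {0..<int p} \<subseteq> {0..<int p}"
    using pos by auto
  ultimately show ?thesis
    by (simp add: bij_betw_def endo_inj_surj)
qed

locale prime_circulant =
  fixes p :: nat and S :: "int set"
  assumes prime_p: "Factorial_Ring.prime p" and S_subset: "S \<subseteq> {1..<int p}"
begin

definition G :: "int pair_pre_digraph" where
  "G = cayley_graph (integer_mod_group p) S"

lemma p_gt_1: "1 < p"
  using prime_p prime_gt_1_nat by blast

lemma pverts_G: "pverts G = {0..<int p}"
  using p_gt_1 by (simp add: G_def cayley_graph_def carrier_integer_mod_group)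

lemma in_parcs_G_iff:
  "(u, v) \<in> parcs G \<longleftrightarrow> u \<in> {0..<int p} \<and> v \<in> {0..<int p} \<and> (v - u) mod int p \<in> S"
proof
  assume "(u, v) \<in> parcs G"
  then obtain s where s: "v = (s + u) mod int p" "u \<in> {0..<int p}" "s \<in> S"
    using p_gt_1 by (auto simp: G_def cayley_graph_def carrier_integer_mod_group)
  then have "(v - u) mod int p = s"
    using S_subset by (auto simp: mod_diff_left_eq)
  then show "u \<in> {0..<int p} \<and> v \<in> {0..<int p} \<and> (v - u) mod int p \<in> S"
    using s p_gt_1 by simp
next
  assume *: "u \<in> {0..<int p} \<and> v \<in> {0..<int p} \<and> (v - u) mod int p \<in> S"
  then have "v = ((v - u) mod int p + u) mod int p"
    by (simp add: mod_add_left_eq)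
  then show "(u, v) \<in> parcs G"
    using * p_gt_1 by (auto simp: G_def cayley_graph_def carrier_integer_mod_group)
qed

lemma pair_digraph_G: "pair_digraph G"
proof
  have "parcs G \<subseteq> {0..<int p} \<times> {0..<int p}"
    using in_parcs_G_iff by auto
  then show "finite (parcs G)"
    by (rule finite_subset) simp
  show "fst e \<noteq> snd e" if "e \<in> parcs G" for e
    using that in_parcs_G_iff[of "fst e" "snd e"] S_subset by auto
qed (use in_parcs_G_iff pverts_G in auto)

lemma in_neighbor_colors_G:
  assumes "v \<in> {0..<int p}"
  shows "in_neighbor_colors G d v = image_mset (\<lambda>s. d ((v - s) mod int p)) (mset_set S)"
proof -
  have "{h \<in> pverts G. (h, v) \<in> parcs G} = (\<lambda>s. (v - s) mod int p) ` S"
  proof (intro equalityI subsetI)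
    fix h assume "h \<in> {h \<in> pverts G. (h, v) \<in> parcs G}"
    then have h: "h \<in> {0..<int p}" "(v - h) mod int p \<in> S"
      by (auto simp: in_parcs_G_iff)
    then have "h = (v - (v - h) mod int p) mod int p"
      by (simp add: mod_diff_right_eq)
    then show "h \<in> (\<lambda>s. (v - s) mod int p) ` S"
      using h by blast
  next
    fix h assume "h \<in> (\<lambda>s. (v - s) mod int p) ` S"
    then obtain s where s: "s \<in> S" "h = (v - s) mod int p" by blast
    then have "(v - h) mod int p = s"
      using S_subset by (auto simp: mod_diff_right_eq)
    then show "h \<in> {h \<in> pverts G. (h, v) \<in> parcs G}"
      using s assms p_gt_1 by (simp add: in_parcs_G_iff pverts_G)
  qed
  moreover have "inj_on (\<lambda>s. (v - s) mod int p) S"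
  proof (rule inj_onI)
    fix s s' assume s: "s \<in> S" "s' \<in> S" "(v - s) mod int p = (v - s') mod int p"
    then have "int p dvd s' - s"
      by (simp add: mod_eq_dvd_iff)
    then have "s' mod int p = s mod int p"
      by (simp add: mod_eq_dvd_iff)
    moreover have "s mod int p = s" "s' mod int p = s'"
      using s S_subset by auto
    ultimately show "s = s'" by simp
  qed
  ultimately have "mset_set {h \<in> pverts G. (h, v) \<in> parcs G}
      = image_mset (\<lambda>s. (v - s) mod int p) (mset_set S)"
    by (simp add: image_mset_mset_set)
  then show ?thesis
    by (simp add: in_neighbor_colors_def multiset.map_comp comp_def)
qed

lemma affine_automorphism:
  assumes m: "\<not> int p dvd m" "\<And>z. m * z mod int p \<in> S \<longleftrightarrow> z mod int p \<in> S"
  shows "graph_isomorphism G G (\<lambda>x. (m * x + t) mod int p)"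
  unfolding graph_isomorphism_def pverts_G
proof (intro conjI ballI affine_bij_betw_mod prime_p m(1))
  fix u v assume "u \<in> {0..<int p}" "v \<in> {0..<int p}"
  moreover have "((m * v + t) mod int p - (m * u + t) mod int p) mod int p = m * (v - u) mod int p"
    by (simp add: mod_diff_eq algebra_simps)
  ultimately show "(u, v) \<in> parcs G \<longleftrightarrow>
      ((m * u + t) mod int p, (m * v + t) mod int p) \<in> parcs G"
    using p_gt_1 m(2)[of "v - u"] by (simp add: in_parcs_G_iff)
qed

text \<open>
  The colorings that arise on a vertex-transitive graph: the initial coloring remains constant
  under refinement, and after the first individualization a singleton class remains forever.
\<close>

definition pointed_or_constant :: "(int \<Rightarrow> nat) \<Rightarrow> bool" where
  "pointed_or_constant d \<longleftrightarrow>
    (\<forall>u\<in>pverts G. \<forall>v\<in>pverts G. d u = d v) \<or>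
    (\<exists>a\<in>pverts G. \<forall>u\<in>pverts G. d u = d a \<longrightarrow> u = a)"

lemma pointed_or_constant_refinement_step:
  assumes d: "pointed_or_constant d" and step: "refinement_step G d d'"
  shows "pointed_or_constant d'"
proof (cases "\<forall>u\<in>pverts G. \<forall>v\<in>pverts G. d u = d v")
  case True
  have "in_neighbor_colors G d u = in_neighbor_colors G d v" if "u \<in> pverts G" "v \<in> pverts G" for u v
  proof -
    have "d ((u - s) mod int p) = d ((v - s) mod int p)" for s
      using p_gt_1 by (intro True[rule_format]) (simp_all add: pverts_G)
    then show ?thesis
      using that by (simp add: in_neighbor_colors_G pverts_G)
  qed
  then show ?thesis
    using True step unfolding pointed_or_constant_def refinement_step_def by blast
next
  case False
  then show ?thesis
    using d step unfolding pointed_or_constant_def refinement_step_def by blast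
qed

text \<open>
  Every permutation is an automorphism of an empty or complete graph; transpositions suffice
  to move a vertex within its color class.
\<close>

lemma trivial_connection_set_automorphism:
  assumes S: "S = {} \<or> S = {1..<int p}" and uv: "u \<in> pverts G" "v \<in> pverts G"
  shows "graph_isomorphism G G (id(u := v, v := u))"
proof -
  have "(a, b) \<in> parcs G \<longleftrightarrow> a \<in> pverts G \<and> b \<in> pverts G \<and> S \<noteq> {} \<and> a \<noteq> b" for a b
  proof -
    have "(b - a) mod int p \<in> {1..<int p} \<longleftrightarrow> a \<noteq> b" if "a \<in> pverts G" "b \<in> pverts G"
    proof -
      have "(b - a) mod int p = 0 \<longleftrightarrow> a mod int p = b mod int p"
        by (metis mod_eq_dvd_iff dvd_eq_mod_eq_0)
      moreover have "0 \<le> (b - a) mod int p" "(b - a) mod int p < int p"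
        using p_gt_1 by auto
      then have "(b - a) mod int p \<in> {1..<int p} \<longleftrightarrow> (b - a) mod int p \<noteq> 0"
        unfolding atLeastLessThan_iff by linarith
      ultimately show ?thesis
        using that by (simp add: pverts_G)
    qed
    then show ?thesis
      using S by (auto simp: in_parcs_G_iff pverts_G)
  qed
  moreover have bij: "bij_betw (id(u := v, v := u)) (pverts G) (pverts G)"
    using uv by (auto simp: bij_betw_def inj_on_def image_iff split: if_splits)
  moreover have "(id(u := v, v := u)) x \<in> pverts G" if "x \<in> pverts G" for x
    using uv that by simp
  moreover have "(id(u := v, v := u)) x = (id(u := v, v := u)) y \<longleftrightarrow> x = y"
    if "x \<in> pverts G" "y \<in> pverts G" for x y
    using inj_on_eq_iff[OF bij_betw_imp_inj_on[OF bij] that] .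
  ultimately show ?thesis
    unfolding graph_isomorphism_def by metis
qed

lemma color_class_is_orbit:
  assumes d: "pointed_or_constant d" and stable: "stable G d"
    and uv: "u \<in> pverts G" "v \<in> pverts G" "d u = d v"
  shows "\<exists>\<sigma>. graph_isomorphism G G \<sigma> \<and> (\<forall>x\<in>pverts G. d (\<sigma> x) = d x) \<and> \<sigma> u = v"
proof -
  consider "S = {} \<or> S = {1..<int p}"
    | "\<forall>u\<in>pverts G. \<forall>v\<in>pverts G. d u = d v"
    | a where "S \<noteq> {}" "S \<noteq> {1..<int p}" "a \<in> pverts G" "\<And>u. u \<in> pverts G \<Longrightarrow> d u = d a \<Longrightarrow> u = a"
    using d unfolding pointed_or_constant_def by blast
  then show ?thesis
  proof cases
    case 1
    then show ?thesis
      using trivial_connection_set_automorphism[of u v] uv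
      by (intro exI[of _ "id(u := v, v := u)"]) auto
  next
    case 2
    let ?\<sigma> = "\<lambda>x. (1 * x + (v - u)) mod int p"
    have "graph_isomorphism G G ?\<sigma>"
      by (rule affine_automorphism) (use p_gt_1 in auto)
    moreover have "d (?\<sigma> x) = d x" if "x \<in> pverts G" for x
      using p_gt_1 that by (intro 2[rule_format]) (simp_all add: pverts_G)
    moreover have "?\<sigma> u = v" using uv by (simp add: pverts_G)
    ultimately show ?thesis by blast
  next
    case (3 a)
    \<comment> \<open>Move the singleton class \<open>{a}\<close> to \<open>0\<close>.\<close>
    define C where "C x = d ((x + a) mod int p)" for x
    have finite_G: "finite (pverts G)" by (simp add: pverts_G)
    have C_shift: "C (x - a) = d x" if "x \<in> pverts G" for x
      using that by (simp add: C_def pverts_G)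
    interpret pointed_stable_coloring p S C
    proof
      show "C x = C y" if "[x = y] (mod int p)" for x y
        using cong_add[OF that cong_refl[of a]] by (simp add: C_def cong_def)
      show "image_mset (\<lambda>s. C (x - s)) (mset_set S) = image_mset (\<lambda>s. C (y - s)) (mset_set S)"
        if "C x = C y" for x y
      proof -
        have *: "in_neighbor_colors G d ((z + a) mod int p) = image_mset (\<lambda>s. C (z - s)) (mset_set S)" for z
          using p_gt_1 by (simp add: in_neighbor_colors_G C_def mod_diff_left_eq algebra_simps)
        have "in_neighbor_colors G d ((x + a) mod int p) = in_neighbor_colors G d ((y + a) mod int p)"
          using stable[unfolded stable_iff_equitable[OF finite_G], rule_format] that p_gt_1
          unfolding C_def by (simp add: pverts_G)
        then show ?thesis unfolding * .
      qed
      show "int p dvd x" if "C x = C 0" for x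
      proof -
        have "d ((x + a) mod int p) = d a"
          using that \<open>a \<in> pverts G\<close> by (simp add: C_def pverts_G)
        then have "(x + a) mod int p = a"
          using p_gt_1 by (intro 3(4)) (simp_all add: pverts_G)
        then have "[x + a = 0 + a] (mod int p)"
          using \<open>a \<in> pverts G\<close> by (simp add: cong_def pverts_G)
        then have "[x = 0] (mod int p)"
          by (simp only: cong_add_rcancel)
        then show ?thesis
          by (simp add: cong_0_iff)
      qed
    qed (use prime_p S_subset 3(1,2) in auto)
    have "C (u - a) = C (v - a)"
      using uv by (simp add: C_shift)
    then obtain m where m: "\<not> int p dvd m" "[m * (u - a) = v - a] (mod int p)"
      "\<And>z. C (m * z) = C z" "\<And>z. m * z mod int p \<in> S \<longleftrightarrow> z mod int p \<in> S"
      using color_class_multiplier by blast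
    let ?\<sigma> = "\<lambda>x. (m * x + (a - m * a)) mod int p"
    have eq: "m * x + (a - m * a) = m * (x - a) + a" for x
      by (simp add: algebra_simps)
    have "graph_isomorphism G G ?\<sigma>"
      by (rule affine_automorphism) (use m in auto)
    moreover have "d (?\<sigma> x) = d x" if "x \<in> pverts G" for x
      using m(3)[of "x - a"] C_shift[OF that] unfolding eq by (simp add: C_def)
    moreover have "?\<sigma> u = v"
      using cong_add[OF m(2) cong_refl[of a]] uv(2) unfolding eq by (simp add: cong_def pverts_G)
    ultimately show ?thesis by blast
  qed
qed

lemma tinhofer_property_G: "tinhofer_property TYPE('b) G"
proof (rule tinhofer_property_criterion[where J = pointed_or_constant])
  show "pointed_or_constant (d(v := k))" if "v \<in> pverts G" "k \<notin> d ` pverts G" for d v k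
    using that unfolding pointed_or_constant_def by (intro disjI2 bexI[of _ v]) auto
qed (use pair_digraph_G pointed_or_constant_refinement_step color_class_is_orbit
    in \<open>auto simp: pointed_or_constant_def\<close>)

end

theorem theorem4:
  fixes p :: nat and G :: "int pair_pre_digraph"
  assumes "Factorial_Ring.prime p"
    and "circulant_graph p G"
  shows "tinhofer_property TYPE('b) G"
proof -
  have pos: "p \<noteq> 0"
    using assms(1) by (metis not_prime_0)
  obtain S where S: "S \<subseteq> carrier (integer_mod_group p) - {0}" and G: "G = cayley_graph (integer_mod_group p) S"
    using assms(2) by (auto simp: circulant_graph_def)
  interpret C: prime_circulant p S
    using assms(1) S pos by unfold_locales (auto simp: carrier_integer_mod_group)
  show ?thesis
    using C.tinhofer_property_G unfolding C.G_def G .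
qed

end
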